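(* Let $p\ge 1$ and let $X_1,\dots,X_n$ be points of the tree space $\mathcal{T}_{p+2}$ (a sample from some density). Suppose that the log-likelihood $l(g)=\sum_{i=1}^n\log g(X_i)$ has a maximizer in $\bar{\mathcal{F}}_0$. Then this maximizer is unique $\nu$-almost everywhere: if $f_1,f_2\in\bar{\mathcal{F}}_0$ both maximize $l$ over $\bar{\mathcal{F}}_0$, then $f_1=f_2$ $\nu$-a.e.
   Context: $\mathcal{T}_{p+2}$ is the Billera–Holmes–Vogtmann space of metric phylogenetic trees with $p+3$ labelled leaves (one of them a root): it is the union of $(2p+1)!!$ closed nonnegative orthants $\mathbb{R}_{\ge 0}^{p}$, one for each binary tree topology, whose coordinates are the lengths of the $p$ internal edges (splits) of that topology; orthants are glued along common faces corresponding to shared splits (a face where some coordinates are zero represents the non-binary tree obtained by contracting those edges), and the point with all coordinates zero is the origin. It carries the induced intrinsic (geodesic) metric $d$, under which it is a Hadamard (CAT(0)) space. The measure $\nu$ is defined by $\nu(A)=\sum_i\nu_B(A_i)$, where $A_i$ is the part of $A$ in the interior of the $i$-th orthant and $\nu_B$ is Lebesgue measure on $\mathbb{R}^p$ (so the union of orthant boundaries has measure zero), completed. Concavity on a Hadamard space: a function $\phi:\mathcal{T}_{p+2}\to[-\infty,\infty]$ is concave if its hypograph $\{(x,\mu):\mu\le\phi(x)\}$ is a convex subset of $\mathcal{T}_{p+2}\times\mathbb{R}$, i.e. contains the unique geodesic between any two of its points. A probability density $g$ (w.r.t. $\nu$) is log-concave if $\log g$ (with $\log 0=-\infty$) is concave.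 $\bar{\mathcal{F}}_0$ is the set of upper-semicontinuous log-concave probability densities with respect to $\nu$ on $\mathcal{T}_{p+2}$. *)

theory Defs
  imports "HOL-Analysis.Analysis" "HOL-Probability.Probability"
begin

text \<open>BHV tree space T_{p+2}: leaves labelled 0,1,...,p+2, leaf 0 being the root.
  An internal edge (split) of a rooted tree is identified with its clade, the set of
  non-root leaves below it; nontrivial clades have between 2 and p+1 elements.
  A point of tree space is a function assigning a length to every clade, nonnegative,
  and supported in (the clade set of) some binary topology.\<close>

definition clades :: "nat \<Rightarrow> nat set set" where
  "clades p = {S. S \<subseteq> {1..p+2} \<and> 2 \<le> card S \<and> card S \<le> p + 1}"

definition compatible :: "nat set \<Rightarrow> nat set \<Rightarrow> bool" where
  "compatible S T \<longleftrightarrow> S \<subseteq> T \<or> T \<subseteq> S \<or> S \<inter> T = {}"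

text \<open>binary tree topologies = maximal pairwise compatible sets of clades\<close>
definition topologies :: "nat \<Rightarrow> nat set set set" where
  "topologies p = {C. C \<subseteq> clades p \<and> (\<forall>S\<in>C. \<forall>T\<in>C. compatible S T) \<and>
      (\<forall>S\<in>clades p - C. \<exists>T\<in>C. \<not> compatible S T)}"

type_synonym tree = "nat set \<Rightarrow> real"

definition orthant :: "nat \<Rightarrow> nat set set \<Rightarrow> tree set" where
  "orthant p C = {w. (\<forall>S. 0 \<le> w S) \<and> (\<forall>S. w S \<noteq> 0 \<longrightarrow> S \<in> C)}"

definition treespace :: "nat \<Rightarrow> tree set" where
  "treespace p = (\<Union>C\<in>topologies p. orthant p C)"

definition eucl_dist :: "nat \<Rightarrow> tree \<Rightarrow> tree \<Rightarrow> real" where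
  "eucl_dist p x y = sqrt (\<Sum>S\<in>clades p. (x S - y S)\<^sup>2)"

definition common_orthant :: "nat \<Rightarrow> tree \<Rightarrow> tree \<Rightarrow> bool" where
  "common_orthant p x y \<longleftrightarrow> (\<exists>C\<in>topologies p. x \<in> orthant p C \<and> y \<in> orthant p C)"

definition chain :: "nat \<Rightarrow> tree \<Rightarrow> tree \<Rightarrow> tree list \<Rightarrow> bool" where
  "chain p x y zs \<longleftrightarrow> zs \<noteq> [] \<and> hd zs = x \<and> last zs = y \<and> set zs \<subseteq> treespace p \<and>
      (\<forall>i. Suc i < length zs \<longrightarrow> common_orthant p (zs ! i) (zs ! Suc i))"

definition chain_length :: "nat \<Rightarrow> tree list \<Rightarrow> real" where
  "chain_length p zs = (\<Sum>i<length zs - 1. eucl_dist p (zs ! i) (zs ! Suc i))"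

definition bhv_dist :: "nat \<Rightarrow> tree \<Rightarrow> tree \<Rightarrow> real" where
  "bhv_dist p x y = Inf {chain_length p zs | zs. chain p x y zs}"

definition geodesic :: "'a set \<Rightarrow> ('a \<Rightarrow> 'a \<Rightarrow> real) \<Rightarrow> 'a \<Rightarrow> 'a \<Rightarrow> (real \<Rightarrow> 'a) \<Rightarrow> bool" where
  "geodesic X dd a b \<gamma> \<longleftrightarrow> \<gamma> 0 = a \<and> \<gamma> 1 = b \<and> (\<forall>t\<in>{0..1}. \<gamma> t \<in> X) \<and>
      (\<forall>s\<in>{0..1}. \<forall>t\<in>{0..1}. dd (\<gamma> s) (\<gamma> t) = \<bar>s - t\<bar> * dd a b)"

definition prod_dist :: "nat \<Rightarrow> tree \<times> real \<Rightarrow> tree \<times> real \<Rightarrow> real" where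
  "prod_dist p u v = sqrt ((bhv_dist p (fst u) (fst v))\<^sup>2 + (snd u - snd v)\<^sup>2)"

definition hypograph :: "nat \<Rightarrow> (tree \<Rightarrow> ereal) \<Rightarrow> (tree \<times> real) set" where
  "hypograph p \<phi> = {(x, \<mu>). x \<in> treespace p \<and> ereal \<mu> \<le> \<phi> x}"

definition concave_tree :: "nat \<Rightarrow> (tree \<Rightarrow> ereal) \<Rightarrow> bool" where
  "concave_tree p \<phi> \<longleftrightarrow> (\<forall>a\<in>hypograph p \<phi>. \<forall>b\<in>hypograph p \<phi>. \<forall>\<gamma>.
      geodesic (treespace p \<times> UNIV) (prod_dist p) a b \<gamma> \<longrightarrow>
      (\<forall>t\<in>{0..1}. \<gamma> t \<in> hypograph p \<phi>))"

definition elog :: "real \<Rightarrow> ereal" where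
  "elog r = (if r = 0 then -\<infinity> else ereal (ln r))"

definition usc_tree :: "nat \<Rightarrow> (tree \<Rightarrow> real) \<Rightarrow> bool" where
  "usc_tree p g \<longleftrightarrow> (\<forall>x\<in>treespace p. \<forall>c. g x < c \<longrightarrow>
      (\<exists>e>0. \<forall>y\<in>treespace p. bhv_dist p x y < e \<longrightarrow> g y < c))"

text \<open>The measure nu: sum over binary topologies C of Lebesgue measure on R^C restricted to
  the interior of the orthant (positive coordinates), pulled back along the embedding.\<close>
definition emb :: "nat set set \<Rightarrow> tree \<Rightarrow> tree" where
  "emb C x = (\<lambda>S. if S \<in> C then x S else 0)"

definition open_part :: "nat set set \<Rightarrow> tree set \<Rightarrow> tree set" where
  "open_part C A = {x \<in> space (PiM C (\<lambda>_. lborel)). (\<forall>S\<in>C. 0 < x S) \<and> emb C x \<in> A}"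

definition nu_sets :: "nat \<Rightarrow> tree set set" where
  "nu_sets p = {A. A \<subseteq> treespace p \<and>
      (\<forall>C\<in>topologies p. open_part C A \<in> sets (PiM C (\<lambda>_. lborel)))}"

definition nu0 :: "nat \<Rightarrow> tree measure" where
  "nu0 p = measure_of (treespace p) (nu_sets p)
      (\<lambda>A. \<Sum>C\<in>topologies p. emeasure (PiM C (\<lambda>_. lborel)) (open_part C A))"

definition nu :: "nat \<Rightarrow> tree measure" where
  "nu p = completion (nu0 p)"

definition prob_density :: "nat \<Rightarrow> (tree \<Rightarrow> real) \<Rightarrow> bool" where
  "prob_density p g \<longleftrightarrow> g \<in> borel_measurable (nu p) \<and> (\<forall>x\<in>treespace p. 0 \<le> g x) \<and>
      (\<integral>\<^sup>+ x. ennreal (g x) \<partial>nu p) = 1"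

definition log_concave :: "nat \<Rightarrow> (tree \<Rightarrow> real) \<Rightarrow> bool" where
  "log_concave p g \<longleftrightarrow> concave_tree p (\<lambda>x. elog (g x))"

definition F0 :: "nat \<Rightarrow> (tree \<Rightarrow> real) set" where
  "F0 p = {g. prob_density p g \<and> usc_tree p g \<and> log_concave p g}"

definition loglik :: "nat \<Rightarrow> (nat \<Rightarrow> tree) \<Rightarrow> (tree \<Rightarrow> real) \<Rightarrow> ereal" where
  "loglik n X g = (\<Sum>i<n. elog (g (X i)))"

definition is_mle :: "nat \<Rightarrow> nat \<Rightarrow> (nat \<Rightarrow> tree) \<Rightarrow> (tree \<Rightarrow> real) \<Rightarrow> bool" where
  "is_mle p n X f \<longleftrightarrow> f \<in> F0 p \<and> (\<forall>g\<in>F0 p. loglik n X g \<le> loglik n X f)"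

end

theory Submission
  imports Defs
begin

text \<open>
  Two maximizers are compared with the normalized geometric mean \<open>sqrt (f1 * f2)\<close>, which is again
  upper semicontinuous and log-concave. By the arithmetic-geometric mean inequality its mass \<open>Z\<close> is
  at most 1, and the log-likelihood of the normalized function exceeds the maximum by \<open>- n * ln Z\<close>,
  so \<open>Z = 1\<close> and \<open>f1 = f2\<close> almost everywhere.

  This needs a finite maximal log-likelihood and \<open>Z > 0\<close>, and both use the CAT(0) geometry of tree
  space. The maximum is finite because the uniform density on a large ball around the origin is
  log-concave. If \<open>Z = 0\<close>, then \<open>K = {f1 \<ge> c, f2 \<ge> c}\<close> is, for small \<open>c\<close>, a closed convex null set
  that contains the sample, the distance to \<open>K\<close> is a convex function, and \<open>f1 * exp (- dist K)\<close> has
  mass less than 1 but the same values as \<open>f1\<close> at the sample.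

  The CAT(0) inequality is proved by Reshetnyak gluing: if the clades \<open>u\<close> and \<open>v\<close> are incompatible,
  the trees with clades in \<open>W\<close> are the union of those with clades in \<open>W - {u}\<close> and \<open>W - {v}\<close>,
  both convex because coordinate projections are 1-Lipschitz.
\<close>

subsection \<open>Gluing spaces of nonpositive curvature\<close>

lemma sum_square_le_weighted:
  fixes P Q \<mu> :: real
  assumes "0 < \<mu>" "\<mu> < 1"
  shows "(P + Q)\<^sup>2 \<le> P\<^sup>2 / \<mu> + Q\<^sup>2 / (1 - \<mu>)"
proof -
  have "P\<^sup>2 / \<mu> + Q\<^sup>2 / (1 - \<mu>) - (P + Q)\<^sup>2 = ((1 - \<mu>) * P - \<mu> * Q)\<^sup>2 / (\<mu> * (1 - \<mu>))"
    using assms by (simp add: field_simps power2_eq_square)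
  moreover have "\<dots> \<ge> 0"
    using assms by simp
  ultimately show ?thesis by linarith
qed

locale geodesic_metric =
  fixes M :: "'a set" and d :: "'a \<Rightarrow> 'a \<Rightarrow> real"
  assumes nonneg: "x \<in> M \<Longrightarrow> y \<in> M \<Longrightarrow> 0 \<le> d x y"
    and sym: "x \<in> M \<Longrightarrow> y \<in> M \<Longrightarrow> d x y = d y x"
    and zero: "x \<in> M \<Longrightarrow> y \<in> M \<Longrightarrow> d x y = 0 \<longleftrightarrow> x = y"
    and tri: "x \<in> M \<Longrightarrow> y \<in> M \<Longrightarrow> z \<in> M \<Longrightarrow> d x z \<le> d x y + d y z"
    and geod: "x \<in> M \<Longrightarrow> y \<in> M \<Longrightarrow> 0 \<le> t \<Longrightarrow> t \<le> 1 \<Longrightarrow>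
      \<exists>m\<in>M. d x m = t * d x y \<and> d m y = (1 - t) * d x y"
begin

definition dpt :: "'a \<Rightarrow> 'a \<Rightarrow> real \<Rightarrow> 'a \<Rightarrow> bool" where
  "dpt x y t m \<longleftrightarrow> 0 \<le> t \<and> t \<le> 1 \<and> m \<in> M \<and> d x m = t * d x y \<and> d m y = (1 - t) * d x y"

definition gconvex :: "'a set \<Rightarrow> bool" where
  "gconvex A \<longleftrightarrow> A \<subseteq> M \<and> (\<forall>x\<in>A. \<forall>y\<in>A. \<forall>t m. dpt x y t m \<longrightarrow> m \<in> A)"

definition CN :: "'a \<Rightarrow> 'a \<Rightarrow> 'a \<Rightarrow> bool" where
  "CN z x y \<longleftrightarrow> (\<forall>t m. dpt x y t m \<longrightarrow>
     (d z m)\<^sup>2 \<le> (1 - t) * (d z x)\<^sup>2 + t * (d z y)\<^sup>2 - t * (1 - t) * (d x y)\<^sup>2)"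

definition cat0 :: "'a set \<Rightarrow> bool" where
  "cat0 A \<longleftrightarrow> (\<forall>z\<in>A. \<forall>x\<in>A. \<forall>y\<in>A. CN z x y)"

lemma dpt_sym: "x \<in> M \<Longrightarrow> y \<in> M \<Longrightarrow> dpt x y t m \<Longrightarrow> dpt y x (1 - t) m"
  unfolding dpt_def using sym by auto

lemma dpt_exists: "x \<in> M \<Longrightarrow> y \<in> M \<Longrightarrow> 0 \<le> t \<Longrightarrow> t \<le> 1 \<Longrightarrow> \<exists>m. dpt x y t m"
  unfolding dpt_def using geod by blast

lemma CN_D: "CN z x y \<Longrightarrow> dpt x y t m \<Longrightarrow>
     (d z m)\<^sup>2 \<le> (1 - t) * (d z x)\<^sup>2 + t * (d z y)\<^sup>2 - t * (1 - t) * (d x y)\<^sup>2"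
  unfolding CN_def by blast

lemma CN_sym: "x \<in> M \<Longrightarrow> y \<in> M \<Longrightarrow> CN z x y \<Longrightarrow> CN z y x"
  unfolding CN_def
proof (intro allI impI)
  fix t m
  assume M: "x \<in> M" "y \<in> M" and *: "\<forall>t m. dpt x y t m \<longrightarrow>
     (d z m)\<^sup>2 \<le> (1 - t) * (d z x)\<^sup>2 + t * (d z y)\<^sup>2 - t * (1 - t) * (d x y)\<^sup>2"
    and "dpt y x t m"
  then have "dpt x y (1 - t) m" using dpt_sym by blast
  with * have "(d z m)\<^sup>2 \<le> (1 - (1 - t)) * (d z x)\<^sup>2 + (1 - t) * (d z y)\<^sup>2 - (1 - t) * (1 - (1 - t)) * (d x y)\<^sup>2"
    by blast
  then show "(d z m)\<^sup>2 \<le> (1 - t) * (d z y)\<^sup>2 + t * (d z x)\<^sup>2 - t * (1 - t) * (d y x)\<^sup>2"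
    using sym[OF M] by (simp add: algebra_simps)
qed

lemma gconvex_subset: "gconvex A \<Longrightarrow> x \<in> A \<Longrightarrow> x \<in> M"
  unfolding gconvex_def by blast

lemma gconvexD: "gconvex A \<Longrightarrow> x \<in> A \<Longrightarrow> y \<in> A \<Longrightarrow> dpt x y t m \<Longrightarrow> m \<in> A"
  unfolding gconvex_def by blast

lemma cat0D: "cat0 A \<Longrightarrow> z \<in> A \<Longrightarrow> x \<in> A \<Longrightarrow> y \<in> A \<Longrightarrow> CN z x y"
  unfolding cat0_def by blast

text \<open>The point \<open>c\<close> cuts the triangle \<open>z a x\<close> into \<open>z a c\<close> and \<open>a c x\<close>. The parameters \<open>\<tau>\<close> and
  \<open>\<mu>\<close> locate the intersection of the segments \<open>[a,c]\<close> and \<open>[z,m]\<close> in a Euclidean triangle; with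
  them the terms in \<open>d a c\<close> cancel.\<close>
lemma CN_split:
  assumes Y: "gconvex Y" "cat0 Y" and z: "z \<in> M" and a: "a \<in> Y" and c: "c \<in> Y" and x: "x \<in> Y"
    and cz: "d z c + d c x = d z x" and CN: "CN z a c"
  shows "CN z a x"
proof -
  have M: "a \<in> M" "c \<in> M" "x \<in> M" using gconvex_subset[OF Y(1)] a c x by blast+
  consider "z = c" | "c = x" | "z \<noteq> c" "c \<noteq> x" by blast
  then show ?thesis
  proof cases
    case 1
    then show ?thesis using cat0D Y a c x by blast
  next
    case 2
    then show ?thesis using CN by simp
  next
    case 3
    have pos: "0 < d z c" "0 < d c x"
      using 3 zero nonneg z M by (metis order_le_less)+
    define F where "F = d z x"
    define lam where "lam = d z c / F"
    have F: "F > 0" using cz pos unfolding F_def by linarith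
    have lam: "0 < lam" "lam < 1"
      using pos F cz unfolding lam_def F_def by auto
    have p: "d z c = lam * F" and q: "d c x = (1 - lam) * F"
      using F cz[symmetric] unfolding lam_def F_def by (auto simp: field_simps)
    show ?thesis
      unfolding CN_def
    proof (intro allI impI)
      fix s m
      assume m: "dpt a x s m"
      then have s: "0 \<le> s" "s \<le> 1" "m \<in> M" "d a m = s * d a x" "d m x = (1 - s) * d a x"
        unfolding dpt_def by auto
      show "(d z m)\<^sup>2 \<le> (1 - s) * (d z a)\<^sup>2 + s * (d z x)\<^sup>2 - s * (1 - s) * (d a x)\<^sup>2"
      proof (cases "s = 0")
        case True
        then have "m = a" using s zero M by auto
        then show ?thesis using True by simp
      next
        case False
        define N where "N = lam + s * (1 - lam)"
        have N: "N > 0" using lam s unfolding N_def by (simp add: add_pos_nonneg)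
        define \<tau> where "\<tau> = s / N"
        define \<mu> where "\<mu> = lam / N"
        have N1: "N = s + lam * (1 - s)" unfolding N_def by (simp add: algebra_simps)
        have "s \<le> N" unfolding N1 using lam s by simp
        then have tau: "0 \<le> \<tau>" "\<tau> \<le> 1"
          using N s unfolding \<tau>_def by auto
        have mu1: "1 - \<mu> = s * (1 - lam) / N"
          using N unfolding \<mu>_def N_def by (simp add: field_simps)
        have mu: "0 < \<mu>" "\<mu> < 1"
        proof -
          show "0 < \<mu>" using N lam unfolding \<mu>_def by simp
          have "1 - \<mu> > 0" unfolding mu1 using N lam s False by simp
          then show "\<mu> < 1" by simp
        qed
        obtain e where e: "dpt a c \<tau> e" using dpt_exists M tau by blast
        have eY: "e \<in> Y" using gconvexD Y a c e by blast
        have eM: "e \<in> M" using e unfolding dpt_def by simp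
        define \<alpha> h l where "\<alpha> = d z a" and "h = d a c" and "l = d a x"
        have ze: "(d z e)\<^sup>2 \<le> (1 - \<tau>) * \<alpha>\<^sup>2 + \<tau> * (lam * F)\<^sup>2 - \<tau> * (1 - \<tau>) * h\<^sup>2"
          using CN_D[OF CN e] unfolding p \<alpha>_def h_def by simp
        have "CN x a c" "CN e a x" using cat0D Y a c x eY by blast+
        have xe: "(d x e)\<^sup>2 \<le> (1 - \<tau>) * l\<^sup>2 + \<tau> * ((1 - lam) * F)\<^sup>2 - \<tau> * (1 - \<tau>) * h\<^sup>2"
          using CN_D[OF \<open>CN x a c\<close> e] sym[OF M(3) M(1)] sym[OF M(3) M(2)] unfolding q h_def l_def by simp
        have ea: "(d e a) = \<tau> * h"
          using e sym[OF eM M(1)] unfolding dpt_def h_def by simp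
        have em: "(d e m)\<^sup>2 \<le> (1 - s) * (\<tau> * h)\<^sup>2 + s * (d x e)\<^sup>2 - s * (1 - s) * l\<^sup>2"
          using CN_D[OF \<open>CN e a x\<close> m] sym[OF M(3) eM] unfolding ea l_def by simp
        have "s * (d x e)\<^sup>2 \<le> s * ((1 - \<tau>) * l\<^sup>2 + \<tau> * ((1 - lam) * F)\<^sup>2 - \<tau> * (1 - \<tau>) * h\<^sup>2)"
          using xe s by (intro mult_left_mono) auto
        with em have em: "(d e m)\<^sup>2 \<le> (1 - s) * (\<tau> * h)\<^sup>2 + s * ((1 - \<tau>) * l\<^sup>2 + \<tau> * ((1 - lam) * F)\<^sup>2 - \<tau> * (1 - \<tau>) * h\<^sup>2) - s * (1 - s) * l\<^sup>2"
          by linarith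
        have "(d z m)\<^sup>2 \<le> (d z e + d e m)\<^sup>2"
          using tri nonneg z eM s by (intro power_mono) auto
        also have "\<dots> \<le> (d z e)\<^sup>2 / \<mu> + (d e m)\<^sup>2 / (1 - \<mu>)"
          using sum_square_le_weighted mu by blast
        also have "\<dots> \<le> ((1 - \<tau>) * \<alpha>\<^sup>2 + \<tau> * (lam * F)\<^sup>2 - \<tau> * (1 - \<tau>) * h\<^sup>2) / \<mu> +
          ((1 - s) * (\<tau> * h)\<^sup>2 + s * ((1 - \<tau>) * l\<^sup>2 + \<tau> * ((1 - lam) * F)\<^sup>2 - \<tau> * (1 - \<tau>) * h\<^sup>2) - s * (1 - s) * l\<^sup>2) / (1 - \<mu>)"
          using ze em mu by (intro add_mono divide_right_mono) auto
        also have "\<dots> = (1 - s) * \<alpha>\<^sup>2 + s * F\<^sup>2 - s * (1 - s) * l\<^sup>2"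
        proof -
          have t1: "1 - \<tau> = (1 - s) * lam / N"
            using N unfolding \<tau>_def by (simp add: field_simps N_def)
          have i1: "(1 - \<tau>) / \<mu> = 1 - s" "\<tau> / \<mu> = s / lam"
            unfolding t1 unfolding \<mu>_def \<tau>_def using N lam by auto
          have i2: "\<tau> / (1 - \<mu>) = 1 / (1 - lam)"
            unfolding mu1 \<tau>_def using N lam False by auto
          have i3: "(1 - \<tau>) / (1 - \<mu>) = (1 - s) * lam / (s * (1 - lam))"
            unfolding mu1 t1 using N lam False by auto
          have i4: "1 / (1 - \<mu>) = N / (s * (1 - lam))"
            unfolding mu1 by simp
          have "((1 - \<tau>) * \<alpha>\<^sup>2 + \<tau> * (lam * F)\<^sup>2 - \<tau> * (1 - \<tau>) * h\<^sup>2) / \<mu>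
            = (1 - \<tau>) / \<mu> * \<alpha>\<^sup>2 + \<tau> / \<mu> * (lam * F)\<^sup>2 - \<tau> * ((1 - \<tau>) / \<mu>) * h\<^sup>2"
            using mu by (simp add: field_simps)
          also have "\<dots> = (1 - s) * \<alpha>\<^sup>2 + s * lam * F\<^sup>2 - \<tau> * (1 - s) * h\<^sup>2"
            unfolding i1 using lam by (simp add: power2_eq_square)
          finally have A: "((1 - \<tau>) * \<alpha>\<^sup>2 + \<tau> * (lam * F)\<^sup>2 - \<tau> * (1 - \<tau>) * h\<^sup>2) / \<mu>
             = (1 - s) * \<alpha>\<^sup>2 + s * lam * F\<^sup>2 - \<tau> * (1 - s) * h\<^sup>2" .
          have "((1 - s) * (\<tau> * h)\<^sup>2 + s * ((1 - \<tau>) * l\<^sup>2 + \<tau> * ((1 - lam) * F)\<^sup>2 - \<tau> * (1 - \<tau>) * h\<^sup>2) - s * (1 - s) * l\<^sup>2) / (1 - \<mu>)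
            = \<tau> / (1 - \<mu>) * ((\<tau> - s) * h\<^sup>2 + s * ((1 - lam) * F)\<^sup>2 - s * l\<^sup>2) + 1 / (1 - \<mu>) * s\<^sup>2 * l\<^sup>2"
            by (simp add: add_divide_distrib[symmetric] diff_divide_distrib[symmetric])
              (simp add: algebra_simps power2_eq_square)
          also have "\<dots> = (\<tau> - s) / (1 - lam) * h\<^sup>2 + s * (1 - lam) * F\<^sup>2 + (N * s - s) / (1 - lam) * l\<^sup>2"
          proof -
            have "1 / k * ((\<tau> - s) * h\<^sup>2 + s * (k * F)\<^sup>2 - s * l\<^sup>2) + N / (s * k) * s\<^sup>2 * l\<^sup>2 =
              (\<tau> - s) / k * h\<^sup>2 + s * k * F\<^sup>2 + (N * s - s) / k * l\<^sup>2" if "k \<noteq> 0" for k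
              using that False by (simp add: field_simps power2_eq_square)
            from this[of "1 - lam"] show ?thesis unfolding i2 i4 using lam by simp
          qed
          also have "(N * s - s) / (1 - lam) = - s * (1 - s)"
            unfolding N_def using lam by (simp add: field_simps)
          also have "(\<tau> - s) / (1 - lam) = \<tau> * (1 - s)"
          proof -
            have "\<tau> - s = s * (1 - N) / N" unfolding \<tau>_def using N by (simp add: field_simps)
            also have "1 - N = (1 - lam) * (1 - s)" unfolding N_def by (simp add: algebra_simps)
            finally show ?thesis unfolding \<tau>_def using lam by simp
          qed
          finally have B: "((1 - s) * (\<tau> * h)\<^sup>2 + s * ((1 - \<tau>) * l\<^sup>2 + \<tau> * ((1 - lam) * F)\<^sup>2 - \<tau> * (1 - \<tau>) * h\<^sup>2) - s * (1 - s) * l\<^sup>2) / (1 - \<mu>)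
            = \<tau> * (1 - s) * h\<^sup>2 + s * (1 - lam) * F\<^sup>2 + - s * (1 - s) * l\<^sup>2" .
          show ?thesis unfolding A B by (simp add: algebra_simps)
        qed
        finally show ?thesis unfolding \<alpha>_def F_def l_def .
      qed
    qed
  qed
qed

lemma CN_mixed:
  assumes X1: "gconvex X1" "cat0 X1" and X2: "gconvex X2" "cat0 X2"
    and cross: "\<And>x y. x \<in> X1 \<Longrightarrow> y \<in> X2 \<Longrightarrow> \<exists>c\<in>X1 \<inter> X2. d y c + d c x = d y x"
    and z: "z \<in> X2" and x: "x \<in> X1" and y: "y \<in> X1"
  shows "CN z x y"
proof -
  have M: "z \<in> M" "x \<in> M" "y \<in> M"
    using gconvex_subset[OF X1(1)] gconvex_subset[OF X2(1)] x y z by blast+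
  obtain cx where cx: "cx \<in> X1" "cx \<in> X2" "d z cx + d cx x = d z x" using cross x z by blast
  obtain cy where cy: "cy \<in> X1" "cy \<in> X2" "d z cy + d cy y = d z y" using cross y z by blast
  have "CN z cy cx" using cat0D X2 z cx cy by blast
  then have "CN z cy x" using CN_split[OF X1 M(1)] cx cy x by blast
  then have "CN z x cy" using CN_sym M gconvex_subset[OF X1(1)] cy by blast
  then show ?thesis using CN_split[OF X1 M(1)] cy x y by blast
qed

lemma CN_crossing:
  assumes M: "x \<in> M" "y \<in> M" "z \<in> M" and xz: "CN x c z" and yz: "CN y c z"
    and c: "dpt x y lam c"
  shows "(d z c)\<^sup>2 \<le> (1 - lam) * (d z x)\<^sup>2 + lam * (d z y)\<^sup>2 - lam * (1 - lam) * (d x y)\<^sup>2"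
proof -
  have cM: "c \<in> M" and lam: "0 \<le> lam" "lam \<le> 1" and dc: "d x c = lam * d x y" "d c y = (1 - lam) * d x y"
    using c unfolding dpt_def by auto
  consider "lam = 0" | "lam = 1" | "0 < lam" "lam < 1" using lam by linarith
  then show ?thesis
  proof cases
    case 1
    then have "c = x" using dc zero M cM by auto
    then show ?thesis using 1 by simp
  next
    case 2
    then have "c = y" using dc zero M cM by auto
    then show ?thesis using 2 by simp
  next
    case 3
    define h L where "h = d z c" and "L = d x y"
    define R where "R = (1 - lam) * (d z x)\<^sup>2 + lam * (d z y)\<^sup>2 - lam * (1 - lam) * L\<^sup>2"
    have main: "(1 - \<epsilon>) * h\<^sup>2 \<le> R" if e: "0 < \<epsilon>" "\<epsilon> < 1" for \<epsilon>
    proof -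
      obtain e where e': "dpt c z \<epsilon> e" using dpt_exists cM M e by fastforce
      have eM: "e \<in> M" using e' unfolding dpt_def by simp
      have xe: "(d x e)\<^sup>2 \<le> (1 - \<epsilon>) * (lam * L)\<^sup>2 + \<epsilon> * (d z x)\<^sup>2 - \<epsilon> * (1 - \<epsilon>) * h\<^sup>2"
        using CN_D[OF xz e'] sym[OF M(1,3)] sym[OF cM M(3)] dc unfolding h_def L_def by simp
      have ye: "(d e y)\<^sup>2 \<le> (1 - \<epsilon>) * ((1 - lam) * L)\<^sup>2 + \<epsilon> * (d z y)\<^sup>2 - \<epsilon> * (1 - \<epsilon>) * h\<^sup>2"
        using CN_D[OF yz e'] sym[OF M(2,3)] sym[OF cM M(3)] sym[OF eM M(2)] sym[OF cM M(2)] dc unfolding h_def L_def by simp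
      have "L\<^sup>2 \<le> (d x e + d e y)\<^sup>2"
        unfolding L_def using tri nonneg M eM by (intro power_mono) auto
      also have "\<dots> \<le> (d x e)\<^sup>2 / lam + (d e y)\<^sup>2 / (1 - lam)"
        using sum_square_le_weighted 3 by blast
      also have "\<dots> \<le> ((1 - \<epsilon>) * (lam * L)\<^sup>2 + \<epsilon> * (d z x)\<^sup>2 - \<epsilon> * (1 - \<epsilon>) * h\<^sup>2) / lam +
          ((1 - \<epsilon>) * ((1 - lam) * L)\<^sup>2 + \<epsilon> * (d z y)\<^sup>2 - \<epsilon> * (1 - \<epsilon>) * h\<^sup>2) / (1 - lam)"
        using xe ye 3 by (intro add_mono divide_right_mono) auto
      also have "\<dots> = (1 - \<epsilon>) * L\<^sup>2 + \<epsilon> * ((1 - lam) * (d z x)\<^sup>2 + lam * (d z y)\<^sup>2 - (1 - \<epsilon>) * h\<^sup>2) / (lam * (1 - lam))"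
        using 3 by (simp add: field_simps power2_eq_square)
      finally have "\<epsilon> * L\<^sup>2 \<le> \<epsilon> * ((1 - lam) * (d z x)\<^sup>2 + lam * (d z y)\<^sup>2 - (1 - \<epsilon>) * h\<^sup>2) / (lam * (1 - lam))"
        by (simp add: algebra_simps)
      then have "L\<^sup>2 \<le> ((1 - lam) * (d z x)\<^sup>2 + lam * (d z y)\<^sup>2 - (1 - \<epsilon>) * h\<^sup>2) / (lam * (1 - lam))"
        using e by (simp add: times_divide_eq_right[symmetric] del: times_divide_eq_right)
      then have "L\<^sup>2 * (lam * (1 - lam)) \<le> (1 - lam) * (d z x)\<^sup>2 + lam * (d z y)\<^sup>2 - (1 - \<epsilon>) * h\<^sup>2"
        using 3 by (simp add: pos_le_divide_eq)
      then show ?thesis unfolding R_def by (simp add: mult.commute)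
    qed
    have "((\<lambda>\<epsilon>. (1 - \<epsilon>) * h\<^sup>2) \<longlongrightarrow> (1 - 0) * h\<^sup>2) (at_right 0)"
      by (intro tendsto_intros)
    moreover have "eventually (\<lambda>\<epsilon>. (1 - \<epsilon>) * h\<^sup>2 \<le> R) (at_right 0)"
      unfolding eventually_at_right_field using main by (intro exI[of _ 1]) auto
    ultimately have "(1 - 0) * h\<^sup>2 \<le> R"
      by (intro tendsto_upperbound) auto
    then show ?thesis unfolding h_def R_def L_def by simp
  qed
qed

lemma CN_concat:
  assumes M: "x \<in> M" "y \<in> M" "z \<in> M" and c: "dpt x y lam c" and m: "dpt x y t m"
    and zc: "(d z c)\<^sup>2 \<le> (1 - lam) * (d z x)\<^sup>2 + lam * (d z y)\<^sup>2 - lam * (1 - lam) * (d x y)\<^sup>2"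
    and CN: "CN z x c" and mc: "d x m + d m c = d x c"
  shows "(d z m)\<^sup>2 \<le> (1 - t) * (d z x)\<^sup>2 + t * (d z y)\<^sup>2 - t * (1 - t) * (d x y)\<^sup>2"
proof -
  have mM: "m \<in> M" "c \<in> M" using m c unfolding dpt_def by auto
  have dc: "d x c = lam * d x y" "0 \<le> lam" "lam \<le> 1" and dm: "d x m = t * d x y" "0 \<le> t" "t \<le> 1"
    using c m unfolding dpt_def by auto
  show ?thesis
  proof (cases "d x c = 0")
    case True
    then have "d x m = 0" using mc nonneg M mM by (smt (verit))
    then have "m = x" using zero M mM by blast
    moreover have "t * d x y = 0" using \<open>d x m = 0\<close> dm by simp
    moreover have "d x y = 0 \<Longrightarrow> x = y" using zero M by blast
    ultimately show ?thesis by (cases "t = 0") (auto simp: algebra_simps)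
  next
    case False
    then have ne: "lam \<noteq> 0" "d x y \<noteq> 0" using dc by auto
    have dxy: "d x y > 0" using ne nonneg M by (simp add: order_less_le)
    define s where "s = t / lam"
    have t: "t = s * lam" unfolding s_def using ne by simp
    have "t * d x y \<le> lam * d x y" using mc dm dc nonneg mM by (smt (verit))
    then have "t \<le> lam" using dxy by simp
    then have s: "0 \<le> s" "s \<le> 1" unfolding s_def using dm dc ne by auto
    have "dpt x c s m"
      unfolding dpt_def using s mM mc dc dm t by (auto simp: algebra_simps)
    from CN_D[OF CN this] have "(d z m)\<^sup>2 \<le> (1 - s) * (d z x)\<^sup>2 + s * (d z c)\<^sup>2 - s * (1 - s) * (lam * d x y)\<^sup>2"
      unfolding dc .
    also have "\<dots> \<le> (1 - s) * (d z x)\<^sup>2 + s * ((1 - lam) * (d z x)\<^sup>2 + lam * (d z y)\<^sup>2 - lam * (1 - lam) * (d x y)\<^sup>2) - s * (1 - s) * (lam * d x y)\<^sup>2"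
      using zc s by (intro add_mono diff_right_mono mult_left_mono) auto
    also have "\<dots> = (1 - t) * (d z x)\<^sup>2 + t * (d z y)\<^sup>2 - t * (1 - t) * (d x y)\<^sup>2"
      unfolding t by (simp add: algebra_simps power2_eq_square)
    finally show ?thesis .
  qed
qed

lemma dpt_between:
  assumes "x \<in> M" "y \<in> M" "c \<in> M" "d x c + d c y = d x y"
  shows "\<exists>t. dpt x y t c"
proof (cases "d x y = 0")
  case True
  then have "dpt x y 0 c" using assms nonneg unfolding dpt_def
    by (smt (verit, ccfv_SIG) mult_cancel_left1 mult_eq_0_iff)
  then show ?thesis by blast
next
  case False
  then have p: "d x y > 0" using nonneg assms by (simp add: order_less_le)
  have "dpt x y (d x c / d x y) c"
    unfolding dpt_def using p nonneg[of x c] nonneg[of c y] assms(1-3) assms(4)[symmetric]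
    by (auto simp: field_simps)
  then show ?thesis by blast
qed

text \<open>Reshetnyak's gluing theorem.\<close>
theorem cat0_Un:
  assumes X1: "gconvex X1" "cat0 X1" and X2: "gconvex X2" "cat0 X2" and X: "gconvex (X1 \<union> X2)"
    and cross: "\<And>x y. x \<in> X1 \<Longrightarrow> y \<in> X2 \<Longrightarrow> \<exists>c\<in>X1 \<inter> X2. d x c + d c y = d x y"
  shows "cat0 (X1 \<union> X2)"
proof -
  have sub: "X1 \<subseteq> M" "X2 \<subseteq> M" using X1 X2 unfolding gconvex_def by auto
  have cross': "\<exists>c\<in>X1 \<inter> X2. d y c + d c x = d y x" if "x \<in> X1" "y \<in> X2" for x y
    using cross[OF that] sym that sub by (metis IntE add.commute subsetD)
  have cross'': "\<exists>c\<in>X2 \<inter> X1. d y c + d c x = d y x" if "x \<in> X2" "y \<in> X1" for x y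
    using cross[OF that(2,1)] by (simp add: Int_commute)
  have same1: "CN z x y" if "z \<in> X1 \<union> X2" "x \<in> X1" "y \<in> X1" for x y z
    using that CN_mixed[OF X1 X2 cross'] cat0D[OF X1(2)] by blast
  have same2: "CN z x y" if "z \<in> X1 \<union> X2" "x \<in> X2" "y \<in> X2" for x y z
    using that CN_mixed[OF X2 X1 cross''] cat0D[OF X2(2)] by blast
  have diff: "CN z x y" if z: "z \<in> X1 \<union> X2" and x: "x \<in> X1" and y: "y \<in> X2" for x y z
    unfolding CN_def
  proof (intro allI impI)
    fix t m
    assume m: "dpt x y t m"
    have mX: "m \<in> X1 \<union> X2" using gconvexD[OF X] x y m by blast
    have M: "x \<in> M" "y \<in> M" "z \<in> M" "m \<in> M" using x y z sub m unfolding dpt_def by auto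
    have mxy: "d x m + d m y = d x y" using m unfolding dpt_def by (auto simp: algebra_simps)
    have key: "(d z c)\<^sup>2 \<le> (1 - lam) * (d z x)\<^sup>2 + lam * (d z y)\<^sup>2 - lam * (1 - lam) * (d x y)\<^sup>2"
      if c: "c \<in> X1" "c \<in> X2" "dpt x y lam c" for c lam
    proof -
      have "CN x c z" "CN y c z" using z same1 same2 x y c by blast+
      then show ?thesis using CN_crossing M c by blast
    qed
    show "(d z m)\<^sup>2 \<le> (1 - t) * (d z x)\<^sup>2 + t * (d z y)\<^sup>2 - t * (1 - t) * (d x y)\<^sup>2"
    proof (cases "m \<in> X1")
      case True
      then obtain c where c: "c \<in> X1" "c \<in> X2" "d m c + d c y = d m y" using cross y by blast
      then have cM: "c \<in> M" using sub by blast
      have b: "d x c + d c y = d x y" "d x m + d m c = d x c"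
        using c mxy tri[OF M(1,4) cM] tri[OF M(1) cM M(2)] by linarith+
      obtain lam where lam: "dpt x y lam c" using dpt_between[OF M(1,2) cM b(1)] by blast
      show ?thesis
        using CN_concat[OF M(1-3) lam m key[OF c(1,2) lam] same1[OF z x c(1)] b(2)] .
    next
      case False
      then have "m \<in> X2" using mX by blast
      then obtain c where c: "c \<in> X1" "c \<in> X2" "d x c + d c m = d x m" using cross x by blast
      then have cM: "c \<in> M" using sub by blast
      have b: "d x c + d c y = d x y" "d c m + d m y = d c y"
        using c mxy tri[OF cM M(4,2)] tri[OF M(1) cM M(2)] by linarith+
      obtain lam where lam: "dpt x y lam c" using dpt_between[OF M(1,2) cM b(1)] by blast
      have k: "(d z c)\<^sup>2 \<le> (1 - (1 - lam)) * (d z y)\<^sup>2 + (1 - lam) * (d z x)\<^sup>2 - (1 - lam) * (1 - (1 - lam)) * (d y x)\<^sup>2"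
        using key[OF c(1,2) lam] sym[OF M(1,2)] by (simp add: algebra_simps)
      have b': "d y m + d m c = d y c" using b sym M cM by (simp add: add.commute)
      have "(d z m)\<^sup>2 \<le> (1 - (1 - t)) * (d z y)\<^sup>2 + (1 - t) * (d z x)\<^sup>2 - (1 - t) * (1 - (1 - t)) * (d y x)\<^sup>2"
        using CN_concat[OF M(2,1,3) dpt_sym[OF M(1,2) lam] dpt_sym[OF M(1,2) m] k same2[OF z y c(2)] b'] .
      then show ?thesis using sym[OF M(1,2)] by (simp add: algebra_simps)
    qed
  qed
  show ?thesis unfolding cat0_def
  proof (intro ballI)
    fix z x y assume "z \<in> X1 \<union> X2" "x \<in> X1 \<union> X2" "y \<in> X1 \<union> X2"
    then show "CN z x y"
      using same1 same2 diff CN_sym sub by (metis Un_iff subsetD)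
  qed
qed

lemma cat0_dist_convex:
  assumes "cat0 M" "a \<in> M" "b \<in> M" "a' \<in> M" "b' \<in> M" "dpt a b t m" "dpt a' b' t m'"
  shows "d m m' \<le> (1 - t) * d a a' + t * d b b'"
proof -
  have one: "d m m' \<le> t * d b b'"
    if M: "x \<in> M" "b \<in> M" "b' \<in> M" and m: "dpt x b t m" and m': "dpt x b' t m'" for x b b' t m m'
  proof -
    have mM: "m \<in> M" "m' \<in> M" and t: "0 \<le> t" "t \<le> 1" and dm: "d x m' = t * d x b'"
      using m m' unfolding dpt_def by auto
    have "(d m' m)\<^sup>2 \<le> (1 - t) * (d m' x)\<^sup>2 + t * (d m' b)\<^sup>2 - t * (1 - t) * (d x b)\<^sup>2"
      using CN_D[OF cat0D m] assms(1) M mM by blast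
    also have "\<dots> \<le> (1 - t) * (t * d x b')\<^sup>2 + t * ((1 - t) * (d x b)\<^sup>2 + t * (d b b')\<^sup>2 - t * (1 - t) * (d x b')\<^sup>2) - t * (1 - t) * (d x b)\<^sup>2"
      using CN_D[OF cat0D m', of M b] assms(1) M mM t dm sym[OF mM(2) M(1)] sym[OF mM(2) M(2)] sym[OF M(1,2)]
      by (intro add_mono diff_right_mono mult_left_mono) auto
    also have "\<dots> = (t * d b b')\<^sup>2"
      by (simp add: algebra_simps power2_eq_square)
    finally have "d m' m \<le> t * d b b'"
      using t nonneg M by (meson power2_le_imp_le zero_le_mult_iff)
    then show ?thesis using sym mM by simp
  qed
  have t: "0 \<le> t" "t \<le> 1" "m \<in> M" "m' \<in> M" using assms unfolding dpt_def by auto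
  obtain w where w: "dpt a b' t w" using dpt_exists assms t by blast
  then have wM: "w \<in> M" unfolding dpt_def by simp
  have "d m w \<le> t * d b b'" using one assms w by blast
  moreover have "d w m' \<le> (1 - t) * d a a'"
    using one[of b' a a' "1 - t" w m'] dpt_sym assms w by blast
  ultimately show ?thesis using tri[OF t(3) wM t(4)] by linarith
qed

lemma cat0_unique:
  assumes "cat0 M" "a \<in> M" "b \<in> M" "dpt a b t m" "dpt a b t m'"
  shows "m = m'"
proof -
  have M: "m \<in> M" "m' \<in> M" using assms unfolding dpt_def by auto
  have "d m m' \<le> (1 - t) * d a a + t * d b b" using cat0_dist_convex assms by blast
  then have "d m m' = 0" using zero assms nonneg[OF M] by (metis add.right_neutral mult_zero_right order_antisym)
  then show ?thesis using zero M by blast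
qed

lemma cat0_ball_convex:
  assumes "cat0 M" "z \<in> M" "x \<in> M" "y \<in> M" "dpt x y t m" "d z x \<le> r" "d z y \<le> r"
  shows "d z m \<le> r"
proof -
  have t: "0 \<le> t" "t \<le> 1" "m \<in> M" using assms unfolding dpt_def by auto
  have "dpt z z t z" using t assms zero[of z z] unfolding dpt_def by auto
  then have "d z m \<le> (1 - t) * d z x + t * d z y"
    using cat0_dist_convex assms by blast
  also have "\<dots> \<le> (1 - t) * r + t * r" using assms t by (intro add_mono mult_left_mono) auto
  finally show ?thesis by (simp add: algebra_simps)
qed

lemma cat0_geodesic_through:
  assumes "cat0 M" "a \<in> M" "b \<in> M" "dpt a b t m"
  shows "\<exists>\<gamma>. geodesic M d a b \<gamma> \<and> \<gamma> t = m"
proof -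
  have "\<forall>s. \<exists>w. s \<in> {0..1} \<longrightarrow> dpt a b s w" using dpt_exists assms by auto
  then obtain \<gamma> where \<gamma>: "\<And>s. s \<in> {0..1} \<Longrightarrow> dpt a b s (\<gamma> s)" by metis
  have le: "d (\<gamma> s) (\<gamma> r) = (r - s) * d a b" if "0 \<le> s" "s \<le> r" "r \<le> 1" for s r
  proof (cases "r = 0")
    case True
    then have s: "s = 0" "\<gamma> 0 \<in> M" using that \<gamma>[of 0] unfolding dpt_def by auto
    then show ?thesis using True zero by auto
  next
    case False
    have r: "dpt a b r (\<gamma> r)" and s: "dpt a b s (\<gamma> s)" using \<gamma> that by auto
    then have M: "\<gamma> r \<in> M" unfolding dpt_def by simp
    have "0 \<le> s / r" "s / r \<le> 1" using that False by (auto simp: divide_simps)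
    then obtain w where w: "dpt a (\<gamma> r) (s / r) w"
      using dpt_exists[OF assms(2) M] by blast
    then have wM: "w \<in> M" unfolding dpt_def by simp
    have r': "d a (\<gamma> r) = r * d a b" "d (\<gamma> r) b = (1 - r) * d a b" using r unfolding dpt_def by auto
    have w1: "d a w = s * d a b" using w r' False unfolding dpt_def by auto
    have "d w (\<gamma> r) = (1 - s / r) * r * d a b" using w r' unfolding dpt_def by simp
    also have "(1 - s / r) * r = r - s" using False by (simp add: field_simps)
    finally have w2: "d w (\<gamma> r) = (r - s) * d a b" .
    have "d w b \<le> (1 - s) * d a b" using tri[OF wM M assms(3)] w2 r' by (simp add: algebra_simps)
    moreover have "d w b \<ge> (1 - s) * d a b" using tri[OF assms(2) wM assms(3)] w1 by (simp add: algebra_simps)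
    ultimately have "dpt a b s w" unfolding dpt_def using w1 wM that by auto
    then have "w = \<gamma> s" using cat0_unique assms s by blast
    then show ?thesis using w2 by simp
  qed
  have M: "\<gamma> s \<in> M" if "s \<in> {0..1}" for s using \<gamma>[OF that] unfolding dpt_def by simp
  have "d (\<gamma> s) (\<gamma> r) = \<bar>s - r\<bar> * d a b" if "s \<in> {0..1}" "r \<in> {0..1}" for s r
  proof (cases "s \<le> r")
    case True
    then show ?thesis using le that by auto
  next
    case False
    then show ?thesis using le[of r s] sym M that by auto
  qed
  moreover have "\<gamma> 0 = a"
  proof -
    have "d a (\<gamma> 0) = 0" "\<gamma> 0 \<in> M" using \<gamma>[of 0] unfolding dpt_def by auto
    then show ?thesis using zero assms by blast
  qed
  moreover have "\<gamma> 1 = b"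
  proof -
    have "d (\<gamma> 1) b = 0" "\<gamma> 1 \<in> M" using \<gamma>[of 1] unfolding dpt_def by auto
    then show ?thesis using zero assms by blast
  qed
  moreover have "\<gamma> t = m"
  proof -
    have "t \<in> {0..1}" using assms(4) unfolding dpt_def by simp
    then show ?thesis using cat0_unique[OF assms(1-3) _ assms(4)] \<gamma> by blast
  qed
  ultimately show ?thesis unfolding geodesic_def using M by blast
qed

end

subsection \<open>The metric of tree space\<close>

definition compat_set :: "nat \<Rightarrow> nat set set \<Rightarrow> bool" where
  "compat_set p U \<longleftrightarrow> U \<subseteq> clades p \<and> (\<forall>S\<in>U. \<forall>T\<in>U. compatible S T)"

definition supp :: "tree \<Rightarrow> nat set set" where
  "supp w = {S. w S \<noteq> 0}"

lemma finite_clades: "finite (clades p)"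
proof (rule finite_subset)
  show "clades p \<subseteq> Pow {1..p+2}" unfolding clades_def by auto
qed simp

lemma finite_topologies: "finite (topologies p)"
proof (rule finite_subset)
  show "topologies p \<subseteq> Pow (clades p)" unfolding topologies_def by auto
qed (simp add: finite_clades)

lemma compatible_sym: "compatible S T \<Longrightarrow> compatible T S"
  unfolding compatible_def by blast

lemma compatible_refl: "compatible S S"
  unfolding compatible_def by blast

lemma compat_set_subset: "compat_set p U \<Longrightarrow> V \<subseteq> U \<Longrightarrow> compat_set p V"
  unfolding compat_set_def by blast

lemma topologies_compat: "C \<in> topologies p \<Longrightarrow> compat_set p C"
  unfolding topologies_def compat_set_def by blast

lemma compat_set_extend:
  assumes "compat_set p U"
  shows "\<exists>C\<in>topologies p. U \<subseteq> C"
proof -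
  define \<A> where "\<A> = {C. compat_set p C \<and> U \<subseteq> C}"
  have "finite \<A>"
    by (rule finite_subset[of _ "Pow (clades p)"]) (auto simp: \<A>_def compat_set_def finite_clades)
  moreover have "U \<in> \<A>" using assms unfolding \<A>_def by simp
  ultimately obtain C where C: "C \<in> \<A>" "\<And>B. B \<in> \<A> \<Longrightarrow> C \<subseteq> B \<Longrightarrow> C = B"
    using finite_has_maximal[of \<A>] by blast
  have "\<exists>T\<in>C. \<not> compatible S T" if S: "S \<in> clades p - C" for S
  proof (rule ccontr)
    assume "\<not> (\<exists>T\<in>C. \<not> compatible S T)"
    then have "insert S C \<in> \<A>"
      using C(1) S compatible_sym compatible_refl unfolding \<A>_def compat_set_def by blast
    then show False using C(2)[of "insert S C"] S by blast
  qed
  then have "C \<in> topologies p" using C(1) unfolding topologies_def \<A>_def compat_set_def by blast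
  then show ?thesis using C(1) unfolding \<A>_def by blast
qed

lemma treespace_iff: "w \<in> treespace p \<longleftrightarrow> (\<forall>S. 0 \<le> w S) \<and> compat_set p (supp w)"
proof
  assume "w \<in> treespace p"
  then obtain C where "C \<in> topologies p" "w \<in> orthant p C" unfolding treespace_def by blast
  moreover from this have "supp w \<subseteq> C" unfolding orthant_def supp_def by blast
  ultimately show "(\<forall>S. 0 \<le> w S) \<and> compat_set p (supp w)"
    using compat_set_subset[OF topologies_compat] unfolding orthant_def by blast
next
  assume *: "(\<forall>S. 0 \<le> w S) \<and> compat_set p (supp w)"
  then obtain C where "C \<in> topologies p" "supp w \<subseteq> C" using compat_set_extend by blast
  then show "w \<in> treespace p" using * unfolding treespace_def orthant_def supp_def by blast
qed

lemma common_orthant_iff: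
  "common_orthant p x y \<longleftrightarrow> (\<forall>S. 0 \<le> x S) \<and> (\<forall>S. 0 \<le> y S) \<and> compat_set p (supp x \<union> supp y)"
proof
  assume "common_orthant p x y"
  then obtain C where C: "C \<in> topologies p" "x \<in> orthant p C" "y \<in> orthant p C"
    unfolding common_orthant_def by blast
  then have "supp x \<union> supp y \<subseteq> C" unfolding orthant_def supp_def by blast
  then show "(\<forall>S. 0 \<le> x S) \<and> (\<forall>S. 0 \<le> y S) \<and> compat_set p (supp x \<union> supp y)"
    using C compat_set_subset[OF topologies_compat] unfolding orthant_def by blast
next
  assume *: "(\<forall>S. 0 \<le> x S) \<and> (\<forall>S. 0 \<le> y S) \<and> compat_set p (supp x \<union> supp y)"
  then obtain C where C: "C \<in> topologies p" "supp x \<union> supp y \<subseteq> C" using compat_set_extend by blast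
  then show "common_orthant p x y"
    using * unfolding common_orthant_def orthant_def supp_def by blast
qed

lemma common_orthant_sym: "common_orthant p x y \<Longrightarrow> common_orthant p y x"
  unfolding common_orthant_def by blast

lemma common_orthant_treespace: "common_orthant p x y \<Longrightarrow> x \<in> treespace p" "common_orthant p x y \<Longrightarrow> y \<in> treespace p"
  unfolding common_orthant_def treespace_def by blast+

lemma common_orthant_refl: "x \<in> treespace p \<Longrightarrow> common_orthant p x x"
  unfolding common_orthant_def treespace_def by blast

lemma supp_zero [simp]: "supp (\<lambda>_. 0) = {}"
  unfolding supp_def by simp

lemma common_orthant_zero: "x \<in> treespace p \<Longrightarrow> common_orthant p x (\<lambda>_. 0)"
  unfolding common_orthant_iff treespace_iff by simp

lemma zero_in_treespace: "(\<lambda>_. 0) \<in> treespace p"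
  unfolding treespace_iff compat_set_def by simp

lemma eucl_dist_L2: "eucl_dist p x y = L2_set (\<lambda>S. x S - y S) (clades p)"
  unfolding eucl_dist_def L2_set_def by simp

lemma eucl_dist_nonneg: "0 \<le> eucl_dist p x y"
  unfolding eucl_dist_L2 by simp

lemma eucl_dist_sym: "eucl_dist p x y = eucl_dist p y x"
  unfolding eucl_dist_def by (simp add: power2_commute)

lemma eucl_dist_tri: "eucl_dist p x z \<le> eucl_dist p x y + eucl_dist p y z"
  unfolding eucl_dist_L2
  using L2_set_triangle_ineq[of "\<lambda>S. x S - y S" "\<lambda>S. y S - z S" "clades p"] by simp

lemma eucl_dist_self [simp]: "eucl_dist p x x = 0"
  unfolding eucl_dist_def by simp

lemma eucl_dist_sq: "(eucl_dist p x y)\<^sup>2 = (\<Sum>S\<in>clades p. (x S - y S)\<^sup>2)"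
  unfolding eucl_dist_def by (simp add: sum_nonneg)

lemma coord_le_eucl_dist: "S \<in> clades p \<Longrightarrow> \<bar>x S - y S\<bar> \<le> eucl_dist p x y"
  unfolding eucl_dist_def
  using member_le_sum[of S "clades p" "\<lambda>S. (x S - y S)\<^sup>2"] finite_clades
  by (intro real_le_rsqrt) auto

inductive tpath :: "nat \<Rightarrow> tree \<Rightarrow> tree \<Rightarrow> real \<Rightarrow> bool" for p where
  path_refl: "x \<in> treespace p \<Longrightarrow> tpath p x x 0"
| path_step: "common_orthant p x y \<Longrightarrow> tpath p y z L \<Longrightarrow> tpath p x z (eucl_dist p x y + L)"

lemma path_treespace: "tpath p x y L \<Longrightarrow> x \<in> treespace p \<and> y \<in> treespace p"
  by (induction rule: tpath.induct) (auto dest: common_orthant_treespace)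

lemma path_nonneg: "tpath p x y L \<Longrightarrow> 0 \<le> L"
  by (induction rule: tpath.induct) (auto simp: eucl_dist_nonneg)

lemma chain_length_Cons: "chain_length p (a # b # zs) = eucl_dist p a b + chain_length p (b # zs)"
  unfolding chain_length_def by (simp add: sum.lessThan_Suc_shift del: sum.lessThan_Suc)

lemma chain_Cons: "chain p x y (a # b # zs) \<longleftrightarrow> a = x \<and> common_orthant p x b \<and> chain p b y (b # zs)"
proof -
  have "(\<forall>i. Suc i < length (a # b # zs) \<longrightarrow> common_orthant p ((a # b # zs) ! i) ((a # b # zs) ! Suc i))
    \<longleftrightarrow> common_orthant p a b \<and> (\<forall>i. Suc i < length (b # zs) \<longrightarrow> common_orthant p ((b # zs) ! i) ((b # zs) ! Suc i))"
    (is "?l \<longleftrightarrow> ?r")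
  proof
    assume l: ?l
    show ?r
    proof (intro conjI allI impI)
      show "common_orthant p a b" using l[rule_format, of 0] by simp
      show "common_orthant p ((b # zs) ! i) ((b # zs) ! Suc i)" if "Suc i < length (b # zs)" for i
        using l[rule_format, of "Suc i"] that by simp
    qed
  next
    assume r: ?r
    show ?l
    proof (intro allI impI)
      fix i assume "Suc i < length (a # b # zs)"
      then show "common_orthant p ((a # b # zs) ! i) ((a # b # zs) ! Suc i)"
        using r by (cases i) auto
    qed
  qed
  then show ?thesis unfolding chain_def by (auto dest: common_orthant_treespace)
qed

lemma chain_imp_path: "chain p x y zs \<Longrightarrow> tpath p x y (chain_length p zs)"
proof (induction zs arbitrary: x)
  case Nil
  then show ?case by (simp add: chain_def)
next
  case (Cons a zs)
  show ?case
  proof (cases zs)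
    case Nil
    then show ?thesis using Cons.prems by (auto simp: chain_def chain_length_def intro: path_refl)
  next
    case (Cons b us)
    then show ?thesis
      using Cons.IH Cons.prems by (auto simp: chain_Cons chain_length_Cons intro: path_step)
  qed
qed

lemma path_imp_chain: "tpath p x y L \<Longrightarrow> \<exists>zs. chain p x y (x # zs) \<and> chain_length p (x # zs) = L"
proof (induction rule: tpath.induct)
  case (path_refl x)
  then show ?case by (intro exI[of _ "[]"]) (auto simp: chain_def chain_length_def)
next
  case (path_step x y z L)
  then obtain zs where "chain p y z (y # zs)" "chain_length p (y # zs) = L" by blast
  then show ?case using path_step by (intro exI[of _ "y # zs"]) (auto simp: chain_Cons chain_length_Cons)
qed

lemma bhv_dist_path: "bhv_dist p x y = Inf {L. tpath p x y L}"
proof -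
  have "{chain_length p zs | zs. chain p x y zs} = {L. tpath p x y L}"
    using chain_imp_path path_imp_chain by blast
  then show ?thesis unfolding bhv_dist_def by simp
qed

lemma path_trans: "tpath p x y L \<Longrightarrow> tpath p y z L' \<Longrightarrow> tpath p x z (L + L')"
  by (induction rule: tpath.induct) (auto simp: add.assoc intro: path_step)

lemma path_single: "common_orthant p x y \<Longrightarrow> tpath p x y (eucl_dist p x y)"
  using path_step[OF _ path_refl] common_orthant_treespace by fastforce

lemma path_sym: "tpath p x y L \<Longrightarrow> tpath p y x L"
proof (induction rule: tpath.induct)
  case (path_refl x)
  then show ?case by (rule tpath.path_refl)
next
  case (path_step x y z L)
  then show ?case
    using path_trans[OF path_step.IH path_single[OF common_orthant_sym]] by (metis add.commute eucl_dist_sym)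
qed

lemma path_exists: "x \<in> treespace p \<Longrightarrow> y \<in> treespace p \<Longrightarrow> \<exists>L. tpath p x y L"
  using path_trans path_single common_orthant_zero common_orthant_sym by blast

lemma path_ge_eucl: "tpath p x y L \<Longrightarrow> eucl_dist p x y \<le> L"
proof (induction rule: tpath.induct)
  case (path_step x y z L)
  then show ?case using eucl_dist_tri[of p x z y] by linarith
qed simp

lemma path_bdd_below: "bdd_below {L. tpath p x y L}"
  using path_nonneg by (intro bdd_belowI[of _ 0]) auto

lemma bhv_le_path: "tpath p x y L \<Longrightarrow> bhv_dist p x y \<le> L"
  unfolding bhv_dist_path using path_bdd_below by (intro cInf_lower) auto

lemma path_approx:
  assumes "x \<in> treespace p" "y \<in> treespace p" "0 < \<epsilon>"
  shows "\<exists>L. tpath p x y L \<and> L < bhv_dist p x y + \<epsilon>"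
proof -
  have "{L. tpath p x y L} \<noteq> {}" using path_exists assms by blast
  then show ?thesis
    using cInf_lessD[of "{L. tpath p x y L}" "bhv_dist p x y + \<epsilon>"] assms unfolding bhv_dist_path by auto
qed

lemma bhv_greatest:
  assumes "x \<in> treespace p" "y \<in> treespace p" "\<And>L. tpath p x y L \<Longrightarrow> K \<le> L"
  shows "K \<le> bhv_dist p x y"
  using path_exists[OF assms(1,2)] assms(3) unfolding bhv_dist_path by (intro cInf_greatest) auto

lemma bhv_sym: "bhv_dist p x y = bhv_dist p y x"
proof -
  have "{L. tpath p x y L} = {L. tpath p y x L}" using path_sym by blast
  then show ?thesis unfolding bhv_dist_path by simp
qed

lemma bhv_ge_eucl: "x \<in> treespace p \<Longrightarrow> y \<in> treespace p \<Longrightarrow> eucl_dist p x y \<le> bhv_dist p x y"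
  by (intro bhv_greatest path_ge_eucl) auto

lemma bhv_nonneg: "x \<in> treespace p \<Longrightarrow> y \<in> treespace p \<Longrightarrow> 0 \<le> bhv_dist p x y"
  using bhv_ge_eucl eucl_dist_nonneg order_trans by blast

lemma bhv_eq_eucl: "common_orthant p x y \<Longrightarrow> bhv_dist p x y = eucl_dist p x y"
  using bhv_le_path[OF path_single] bhv_ge_eucl common_orthant_treespace by (metis order_antisym)

lemma bhv_tri:
  assumes "x \<in> treespace p" "y \<in> treespace p" "z \<in> treespace p"
  shows "bhv_dist p x z \<le> bhv_dist p x y + bhv_dist p y z"
proof (rule field_le_epsilon)
  fix e :: real assume "0 < e"
  then obtain L1 L2 where "tpath p x y L1" "L1 < bhv_dist p x y + e / 2" "tpath p y z L2" "L2 < bhv_dist p y z + e / 2"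
    using path_approx assms by (metis half_gt_zero)
  then show "bhv_dist p x z \<le> bhv_dist p x y + bhv_dist p y z + e"
    using bhv_le_path[OF path_trans] by fastforce
qed

lemma treespace_outside: "x \<in> treespace p \<Longrightarrow> S \<notin> clades p \<Longrightarrow> x S = 0"
  unfolding treespace_iff compat_set_def supp_def by blast

lemma bhv_zero_iff:
  assumes "x \<in> treespace p" "y \<in> treespace p"
  shows "bhv_dist p x y = 0 \<longleftrightarrow> x = y"
proof
  assume 0: "bhv_dist p x y = 0"
  show "x = y"
  proof
    fix S
    show "x S = y S"
    proof (cases "S \<in> clades p")
      case True
      then show ?thesis
        using coord_le_eucl_dist[OF True, of x y] bhv_ge_eucl[OF assms] 0 by linarith
    next
      case False
      then show ?thesis using treespace_outside assms by metis
    qed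
  qed
next
  assume "x = y"
  then show "bhv_dist p x y = 0" using bhv_eq_eucl[OF common_orthant_refl] assms by simp
qed

definition proj :: "nat set set \<Rightarrow> tree \<Rightarrow> tree" where
  "proj W w = (\<lambda>S. if S \<in> W then w S else 0)"

lemma supp_proj: "supp (proj W w) = supp w \<inter> W"
  unfolding supp_def proj_def by auto

lemma proj_treespace: "w \<in> treespace p \<Longrightarrow> proj W w \<in> treespace p"
  unfolding treespace_iff supp_proj by (auto simp: proj_def intro: compat_set_subset)

lemma common_orthant_proj: "common_orthant p x y \<Longrightarrow> common_orthant p (proj W x) (proj W y)"
  unfolding common_orthant_iff supp_proj by (auto simp: proj_def intro: compat_set_subset)

lemma eucl_dist_proj:
  "eucl_dist p x y = sqrt ((eucl_dist p (proj W x) (proj W y))\<^sup>2 + (eucl_dist p (proj (- W) x) (proj (- W) y))\<^sup>2)"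
  unfolding eucl_dist_sq unfolding eucl_dist_def sum.distrib[symmetric]
  by (intro arg_cong[where f = sqrt] sum.cong) (auto simp: proj_def)

lemma path_proj:
  "tpath p x y L \<Longrightarrow> \<exists>K. tpath p (proj W x) (proj W y) K \<and>
     sqrt (K\<^sup>2 + (eucl_dist p (proj (- W) x) (proj (- W) y))\<^sup>2) \<le> L"
proof (induction rule: tpath.induct)
  case (path_refl x)
  then show ?case by (intro exI[of _ 0]) (auto intro: tpath.path_refl proj_treespace)
next
  case (path_step x y z L)
  then obtain K where K: "tpath p (proj W y) (proj W z) K"
    "sqrt (K\<^sup>2 + (eucl_dist p (proj (- W) y) (proj (- W) z))\<^sup>2) \<le> L" by blast
  let ?a = "eucl_dist p (proj W x) (proj W y)" and ?b = "eucl_dist p (proj (- W) x) (proj (- W) y)"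
    and ?c = "eucl_dist p (proj (- W) y) (proj (- W) z)"
  have "sqrt ((?a + K)\<^sup>2 + (eucl_dist p (proj (- W) x) (proj (- W) z))\<^sup>2) \<le> sqrt ((?a + K)\<^sup>2 + (?b + ?c)\<^sup>2)"
    by (intro real_sqrt_le_mono add_left_mono power_mono eucl_dist_tri eucl_dist_nonneg)
  also have "\<dots> \<le> sqrt (?a\<^sup>2 + ?b\<^sup>2) + sqrt (K\<^sup>2 + ?c\<^sup>2)"
    by (rule real_sqrt_sum_squares_triangle_ineq)
  also have "\<dots> \<le> eucl_dist p x y + L" using K eucl_dist_proj[of p x y W] by simp
  finally show ?case using tpath.path_step[OF common_orthant_proj[OF path_step(1)] K(1)] by blast
qed

lemma bhv_proj:
  assumes "x \<in> treespace p" "y \<in> treespace p"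
  shows "sqrt ((bhv_dist p (proj W x) (proj W y))\<^sup>2 + (eucl_dist p (proj (- W) x) (proj (- W) y))\<^sup>2) \<le> bhv_dist p x y"
proof (rule bhv_greatest[OF assms])
  fix L assume "tpath p x y L"
  then obtain K where K: "tpath p (proj W x) (proj W y) K"
     "sqrt (K\<^sup>2 + (eucl_dist p (proj (- W) x) (proj (- W) y))\<^sup>2) \<le> L" using path_proj by blast
  have "(bhv_dist p (proj W x) (proj W y))\<^sup>2 \<le> K\<^sup>2"
    using bhv_le_path[OF K(1)] bhv_nonneg proj_treespace assms by (intro power_mono) auto
  then show "sqrt ((bhv_dist p (proj W x) (proj W y))\<^sup>2 + (eucl_dist p (proj (- W) x) (proj (- W) y))\<^sup>2) \<le> L"
    using K(2) by (smt (verit) real_sqrt_le_mono)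
qed

definition subspace_on :: "nat \<Rightarrow> nat set set \<Rightarrow> tree set" where
  "subspace_on p W = {w \<in> treespace p. supp w \<subseteq> W}"

lemma proj_id: "x \<in> subspace_on p W \<Longrightarrow> proj W x = x"
  unfolding subspace_on_def proj_def supp_def by fastforce

lemma proj_compl: "x \<in> subspace_on p W \<Longrightarrow> proj (- W) x = (\<lambda>_. 0)"
  unfolding subspace_on_def proj_def supp_def by fastforce

lemma bhv_proj_le:
  assumes "x \<in> treespace p" "y \<in> treespace p"
  shows "bhv_dist p (proj W x) (proj W y) \<le> bhv_dist p x y"
proof -
  have "bhv_dist p (proj W x) (proj W y) \<le> sqrt ((bhv_dist p (proj W x) (proj W y))\<^sup>2 + (eucl_dist p (proj (- W) x) (proj (- W) y))\<^sup>2)"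
    by simp
  then show ?thesis using bhv_proj[OF assms, of W] by linarith
qed

lemma subspace_on_between:
  assumes x: "x \<in> subspace_on p W" and y: "y \<in> subspace_on p W" and m: "m \<in> treespace p"
    and between: "bhv_dist p x m + bhv_dist p m y = bhv_dist p x y"
  shows "m \<in> subspace_on p W"
proof (rule ccontr)
  assume "m \<notin> subspace_on p W"
  then obtain S where S: "m S \<noteq> 0" "S \<notin> W" using m unfolding subspace_on_def supp_def by blast
  have T: "x \<in> treespace p" "y \<in> treespace p" using x y unfolding subspace_on_def by auto
  have Sc: "S \<in> clades p" using S treespace_outside m by blast
  have pos: "0 < eucl_dist p (\<lambda>_. 0) (proj (- W) m)"
    using coord_le_eucl_dist[OF Sc, of "\<lambda>_. 0" "proj (- W) m"] S by (auto simp: proj_def)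
  have less: "bhv_dist p z (proj W m) < bhv_dist p z m" if z: "z \<in> subspace_on p W" for z
  proof -
    have zT: "z \<in> treespace p" using z unfolding subspace_on_def by simp
    have "bhv_dist p z (proj W m) = sqrt ((bhv_dist p z (proj W m))\<^sup>2)"
      using bhv_nonneg zT proj_treespace m by simp
    also have "\<dots> < sqrt ((bhv_dist p z (proj W m))\<^sup>2 + (eucl_dist p (\<lambda>_. 0) (proj (- W) m))\<^sup>2)"
      using pos by (intro real_sqrt_less_mono) simp
    also have "\<dots> \<le> bhv_dist p z m" using bhv_proj[OF zT m, of W] proj_id[OF z] proj_compl[OF z] by simp
    finally show ?thesis .
  qed
  have "bhv_dist p x y \<le> bhv_dist p x (proj W m) + bhv_dist p (proj W m) y"
    using bhv_tri T proj_treespace m by blast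
  then show False using less[OF x] less[OF y] between bhv_sym by (smt (verit))
qed

subsection \<open>Tree space is CAT(0)\<close>

definition affine_comb :: "tree \<Rightarrow> tree \<Rightarrow> real \<Rightarrow> tree" where
  "affine_comb x y u = (\<lambda>S. (1 - u) * x S + u * y S)"

lemma eucl_dist_affine_comb:
  "(eucl_dist p z (affine_comb x y t))\<^sup>2 =
     (1 - t) * (eucl_dist p z x)\<^sup>2 + t * (eucl_dist p z y)\<^sup>2 - t * (1 - t) * (eucl_dist p x y)\<^sup>2"
  unfolding eucl_dist_sq sum_distrib_left sum.distrib[symmetric] sum_subtractf[symmetric] affine_comb_def
  by (intro sum.cong) (auto simp: algebra_simps power2_eq_square)

lemma eucl_dist_affine_comb_left:
  assumes "0 \<le> u"
  shows "eucl_dist p x (affine_comb x y u) = u * eucl_dist p x y"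
proof -
  have "(eucl_dist p x (affine_comb x y u))\<^sup>2 = (u * eucl_dist p x y)\<^sup>2"
    unfolding eucl_dist_affine_comb by (simp add: algebra_simps power2_eq_square)
  then show ?thesis using assms eucl_dist_nonneg by (simp add: power2_eq_iff_nonneg)
qed

lemma eucl_dist_affine_comb_right:
  assumes "u \<le> 1"
  shows "eucl_dist p (affine_comb x y u) y = (1 - u) * eucl_dist p x y"
proof -
  have "affine_comb x y u = affine_comb y x (1 - u)"
    unfolding affine_comb_def by (auto simp: algebra_simps)
  then show ?thesis
    using eucl_dist_affine_comb_left[of "1 - u" p y x] assms
    by (simp add: eucl_dist_sym[of p "affine_comb y x (1 - u)" y] eucl_dist_sym[of p x y])
qed

lemma common_orthant_affine_comb:
  assumes "common_orthant p x y" "0 \<le> u" "u \<le> 1"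
  shows "common_orthant p x (affine_comb x y u)" "common_orthant p (affine_comb x y u) y"
proof -
  have "supp (affine_comb x y u) \<subseteq> supp x \<union> supp y"
    unfolding supp_def affine_comb_def by auto
  then have "supp x \<union> supp (affine_comb x y u) \<subseteq> supp x \<union> supp y"
    "supp (affine_comb x y u) \<union> supp y \<subseteq> supp x \<union> supp y" by auto
  moreover have "\<forall>S. 0 \<le> affine_comb x y u S"
    using assms unfolding common_orthant_iff affine_comb_def by simp
  ultimately show "common_orthant p x (affine_comb x y u)" "common_orthant p (affine_comb x y u) y"
    using assms(1) compat_set_subset unfolding common_orthant_iff by blast+
qed

lemma path_cut:
  "tpath p x y L \<Longrightarrow> 0 \<le> r \<Longrightarrow> r \<le> L \<Longrightarrow> \<exists>m. tpath p x m r \<and> tpath p m y (L - r)"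
proof (induction arbitrary: r rule: tpath.induct)
  case (path_refl x)
  then have "r = 0" by simp
  then show ?case using path_refl tpath.path_refl by auto
next
  case (path_step x y z L)
  let ?a = "eucl_dist p x y"
  show ?case
  proof (cases "r \<le> ?a")
    case True
    define u where "u = (if ?a = 0 then 0 else r / ?a)"
    have u: "0 \<le> u" "u \<le> 1" "u * ?a = r"
      using True path_step.prems eucl_dist_nonneg[of p x y] unfolding u_def by (auto simp: divide_simps)
    let ?m = "affine_comb x y u"
    have "tpath p x ?m r"
      using path_single[OF common_orthant_affine_comb(1)[OF path_step(1) u(1,2)]]
        eucl_dist_affine_comb_left[OF u(1)] u by simp
    moreover have "tpath p ?m z ((1 - u) * ?a + L)"
      using tpath.path_step[OF common_orthant_affine_comb(2)[OF path_step(1) u(1,2)] path_step(2)]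
        eucl_dist_affine_comb_right[OF u(2)] by simp
    moreover have "(1 - u) * ?a + L = ?a + L - r" using u(3) by (simp add: algebra_simps)
    ultimately show ?thesis by auto
  next
    case False
    then obtain m where m: "tpath p y m (r - ?a)" "tpath p m z (L - (r - ?a))"
      using path_step.IH[of "r - ?a"] path_step.prems by auto
    have "tpath p x m r" using tpath.path_step[OF path_step(1) m(1)] by simp
    then show ?thesis using m(2) by (auto simp: algebra_simps)
  qed
qed

lemma path_cross:
  assumes "\<not> compatible u v"
  shows "tpath p x y L \<Longrightarrow> x u = 0 \<Longrightarrow> y v = 0 \<Longrightarrow>
    \<exists>c K K'. tpath p x c K \<and> tpath p c y K' \<and> K + K' = L \<and> c u = 0 \<and> c v = 0"
proof (induction rule: tpath.induct)
  case (path_refl x)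
  then show ?case using tpath.path_refl by (metis add.right_neutral)
next
  case (path_step x y z L)
  show ?case
  proof (cases "x v = 0")
    case True
    then show ?thesis
      using tpath.path_step[OF path_step(1,2)] tpath.path_refl[of x p] common_orthant_treespace(1)[OF path_step(1)]
        path_step.prems by (metis add.left_neutral)
  next
    case False
    have "y u = 0"
    proof (rule ccontr)
      assume "y u \<noteq> 0"
      then have "u \<in> supp x \<union> supp y" "v \<in> supp x \<union> supp y" using False unfolding supp_def by auto
      then show False using assms path_step(1) unfolding common_orthant_iff compat_set_def by blast
    qed
    then obtain c K K' where c: "tpath p y c K" "tpath p c z K'" "K + K' = L" "c u = 0" "c v = 0"
      using path_step by blast
    show ?thesis
      using tpath.path_step[OF path_step(1) c(1)] c by (metis add.assoc)
  qed
qed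

lemma tendsto_eucl_dist:
  "((\<lambda>w'. eucl_dist p w' w) \<longlongrightarrow> 0) (at w within K)"
proof -
  have "((\<lambda>w'. sqrt (\<Sum>S\<in>clades p. (w' S - w S)\<^sup>2)) \<longlongrightarrow> sqrt (\<Sum>S\<in>clades p. (w S - w S)\<^sup>2)) (at w within K)"
  proof (intro tendsto_intros)
    fix S
    have "continuous_on UNIV (\<lambda>w' :: tree. w' S)"
      by (rule continuous_on_product_coordinates)
    then show "((\<lambda>w'. w' S) \<longlongrightarrow> w S) (at w within K)"
      unfolding continuous_on_def using tendsto_within_subset by blast
  qed
  then show ?thesis unfolding eucl_dist_def by simp
qed

lemma subspace_attains:
  fixes G :: "tree \<Rightarrow> real"
  assumes Lip: "\<And>m m'. m \<in> treespace p \<Longrightarrow> m' \<in> treespace p \<Longrightarrow> \<bar>G m' - G m\<bar> \<le> B * bhv_dist p m' m"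
    and approx: "\<And>\<epsilon>. \<epsilon> > 0 \<Longrightarrow> \<exists>m\<in>subspace_on p W. bhv_dist p m (\<lambda>_. 0) \<le> R \<and> G m \<le> \<epsilon>"
  shows "\<exists>m\<in>subspace_on p W. G m \<le> 0"
proof -
  define K where "K C = Pi\<^sub>E UNIV (\<lambda>S. if S \<in> C \<inter> W then {0..R} else {0::real})" for C
  have KI: "w \<in> K C \<longleftrightarrow> (\<forall>S. w S \<in> (if S \<in> C \<inter> W then {0..R} else {0}))" for w C
    unfolding K_def PiE_UNIV_domain Pi_iff by simp
  have R: "0 \<le> R"
  proof -
    obtain m where m: "m \<in> subspace_on p W" "bhv_dist p m (\<lambda>_. 0) \<le> R" using approx[of 1] by auto
    then have "0 \<le> bhv_dist p m (\<lambda>_. 0)"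
      using bhv_nonneg zero_in_treespace unfolding subspace_on_def by blast
    then show ?thesis using m(2) by linarith
  qed
  have K_sub: "K C \<subseteq> orthant p C \<inter> subspace_on p W" if C: "C \<in> topologies p" for C
  proof
    fix w assume w: "w \<in> K C"
    have "0 \<le> w S" "w S \<noteq> 0 \<longrightarrow> S \<in> C \<and> S \<in> W" for S
      using w R unfolding KI by (auto dest!: spec[of _ S] split: if_splits)
    then have "w \<in> orthant p C" "supp w \<subseteq> W" unfolding orthant_def supp_def by auto
    then show "w \<in> orthant p C \<inter> subspace_on p W"
      using C unfolding subspace_on_def treespace_def by blast
  qed
  have "\<exists>m\<in>K C. \<forall>w\<in>K C. G m \<le> G w" if C: "C \<in> topologies p" for C
  proof (rule continuous_attains_inf)
    have "compactin (product_topology (\<lambda>S::nat set. euclidean::real topology) UNIV) (K C)"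
      unfolding K_def compactin_PiE by auto
    then show "compact (K C)" by (simp add: euclidean_product_topology)
    have "(\<lambda>_. 0) \<in> K C" unfolding KI using R by simp
    then show "K C \<noteq> {}" by blast
    show "continuous_on (K C) G"
      unfolding continuous_on_def
    proof
      fix w assume w: "w \<in> K C"
      have "((\<lambda>w'. G w' - G w) \<longlongrightarrow> 0) (at w within K C)"
      proof (rule Lim_null_comparison)
        show "\<forall>\<^sub>F w' in at w within K C. norm (G w' - G w) \<le> B * eucl_dist p w' w"
          unfolding eventually_at_filter
        proof (intro always_eventually allI impI)
          fix w' assume w': "w' \<in> K C"
          have co: "common_orthant p w' w"
            using K_sub[OF C] w w' C unfolding common_orthant_def by blast
          then have "norm (G w' - G w) \<le> B * bhv_dist p w' w"
            using Lip common_orthant_treespace[OF co] by simp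
          then show "norm (G w' - G w) \<le> B * eucl_dist p w' w" using bhv_eq_eucl[OF co] by simp
        qed
        show "((\<lambda>w'. B * eucl_dist p w' w) \<longlongrightarrow> 0) (at w within K C)"
          using tendsto_mult[OF tendsto_const tendsto_eucl_dist, of B] by simp
      qed
      then show "(G \<longlongrightarrow> G w) (at w within K C)" using Lim_null by blast
    qed
  qed
  then have "\<forall>C. \<exists>m. C \<in> topologies p \<longrightarrow> m \<in> K C \<and> (\<forall>w\<in>K C. G m \<le> G w)" by blast
  then obtain f where f: "\<And>C. C \<in> topologies p \<Longrightarrow> f C \<in> K C"
    "\<And>C w. C \<in> topologies p \<Longrightarrow> w \<in> K C \<Longrightarrow> G (f C) \<le> G w" by metis
  show ?thesis
  proof (rule ccontr)
    assume "\<not> ?thesis"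
    then have pos: "G (f C) > 0" if "C \<in> topologies p" for C
      using f(1)[OF that] K_sub[OF that] by force
    have ne: "topologies p \<noteq> {}" using zero_in_treespace unfolding treespace_def by blast
    define \<epsilon> where "\<epsilon> = Min ((\<lambda>C. G (f C)) ` topologies p)"
    have e: "\<epsilon> > 0" unfolding \<epsilon>_def using finite_topologies ne pos by (subst Min_gr_iff) auto
    then obtain m where m: "m \<in> subspace_on p W" "bhv_dist p m (\<lambda>_. 0) \<le> R" "G m \<le> \<epsilon> / 2"
      using approx[of "\<epsilon> / 2"] by auto
    then obtain C where C: "C \<in> topologies p" "m \<in> orthant p C"
      unfolding subspace_on_def treespace_def by blast
    have mT: "m \<in> treespace p" using m unfolding subspace_on_def by simp
    have "m \<in> K C"
      unfolding KI
    proof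
      fix S
      show "m S \<in> (if S \<in> C \<inter> W then {0..R} else {0})"
      proof (cases "S \<in> C \<inter> W")
        case True
        then have "S \<in> clades p" using C unfolding topologies_def by blast
        then have "\<bar>m S\<bar> \<le> eucl_dist p m (\<lambda>_. 0)" using coord_le_eucl_dist[of S p m "\<lambda>_. 0"] by simp
        then show ?thesis
          using True m(2) bhv_ge_eucl[OF mT zero_in_treespace] C(2) unfolding orthant_def by auto
      next
        case False
        then show ?thesis using m(1) C(2) unfolding subspace_on_def supp_def orthant_def by auto
      qed
    qed
    then have "\<epsilon> \<le> G m" using f(2)[OF C(1)] Min_le[of "(\<lambda>C. G (f C)) ` topologies p"] C(1) finite_topologies
      unfolding \<epsilon>_def by (meson finite_imageI imageI order_trans)
    then show False using m(3) e by linarith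
  qed
qed

lemma subspace_UNIV: "subspace_on p UNIV = treespace p"
  unfolding subspace_on_def by simp

lemma bhv_Lipschitz:
  assumes "x \<in> treespace p" "m \<in> treespace p" "m' \<in> treespace p"
  shows "\<bar>bhv_dist p x m' - bhv_dist p x m\<bar> \<le> bhv_dist p m' m"
  using bhv_tri[of x p m m'] bhv_tri[of x p m' m] assms bhv_sym[of p m m'] by linarith

lemma bhv_geod:
  assumes x: "x \<in> treespace p" and y: "y \<in> treespace p" and t: "0 \<le> t" "t \<le> 1"
  shows "\<exists>m\<in>treespace p. bhv_dist p x m = t * bhv_dist p x y \<and> bhv_dist p m y = (1 - t) * bhv_dist p x y"
proof -
  let ?D = "bhv_dist p x y"
  define G where "G m = max (bhv_dist p x m - t * ?D) (bhv_dist p y m - (1 - t) * ?D)" for m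
  have "\<exists>m\<in>subspace_on p UNIV. G m \<le> 0"
  proof (rule subspace_attains)
    show "\<bar>G m' - G m\<bar> \<le> 1 * bhv_dist p m' m" if "m \<in> treespace p" "m' \<in> treespace p" for m m'
      using bhv_Lipschitz[OF x that] bhv_Lipschitz[OF y that] unfolding G_def by linarith
    show "\<exists>m\<in>subspace_on p UNIV. bhv_dist p m (\<lambda>_. 0) \<le> ?D + 1 + bhv_dist p x (\<lambda>_. 0) \<and> G m \<le> \<epsilon>"
      if "\<epsilon> > 0" for \<epsilon>
    proof -
      define e where "e = min \<epsilon> 1"
      have e: "e > 0" "e \<le> \<epsilon>" "e \<le> 1" using that unfolding e_def by auto
      obtain L where L: "tpath p x y L" "L < ?D + e" using path_approx[OF x y e(1)] by blast
      have L0: "0 \<le> L" using path_nonneg L by blast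
      obtain m where m: "tpath p x m (t * L)" "tpath p m y (L - t * L)"
        using path_cut[OF L(1), of "t * L"] t L0 by (auto simp: mult_left_le_one_le)
      have mT: "m \<in> treespace p" using path_treespace m by blast
      have "t * L \<le> t * (?D + e)" "(1 - t) * L \<le> (1 - t) * (?D + e)"
        using L t by (auto intro!: mult_left_mono)
      moreover have "t * e \<le> e" "(1 - t) * e \<le> e" using t e by (auto simp: mult_left_le_one_le)
      ultimately have b: "bhv_dist p x m \<le> t * ?D + e" "bhv_dist p y m \<le> (1 - t) * ?D + e"
        using bhv_le_path[OF m(1)] bhv_le_path[OF m(2)] bhv_sym[of p m y]
        by (auto simp: algebra_simps)
      have "t * ?D \<le> ?D" using t bhv_nonneg[OF x y] by (simp add: mult_left_le_one_le)
      then have "bhv_dist p m (\<lambda>_. 0) \<le> ?D + 1 + bhv_dist p x (\<lambda>_. 0)"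
        using bhv_tri[OF mT x zero_in_treespace] b(1) e bhv_sym[of p m x] by linarith
      then show ?thesis using b e mT unfolding subspace_UNIV G_def by (intro bexI[of _ m]) auto
    qed
  qed
  then obtain m where m: "m \<in> treespace p" "bhv_dist p x m \<le> t * ?D" "bhv_dist p m y \<le> (1 - t) * ?D"
    unfolding subspace_UNIV G_def using bhv_sym[of p y] by auto
  then show ?thesis using bhv_tri[OF x m(1) y] by (intro bexI[of _ m]) (auto simp: algebra_simps)
qed

interpretation bhv: geodesic_metric "treespace p" "bhv_dist p" for p
  by unfold_locales (use bhv_nonneg bhv_sym bhv_zero_iff bhv_tri bhv_geod in auto)

lemma gconvex_subspace: "bhv.gconvex p (subspace_on p W)"
  unfolding bhv.gconvex_def
proof (intro conjI ballI allI impI)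
  show "subspace_on p W \<subseteq> treespace p" unfolding subspace_on_def by blast
  fix x y t m
  assume "x \<in> subspace_on p W" "y \<in> subspace_on p W" "bhv.dpt p x y t m"
  then show "m \<in> subspace_on p W"
    using subspace_on_between[of x p W y m] unfolding bhv.dpt_def by (auto simp: algebra_simps)
qed

lemma subspace_cross:
  assumes uv: "\<not> compatible u v"
    and x: "x \<in> subspace_on p (W - {u})" and y: "y \<in> subspace_on p (W - {v})"
  shows "\<exists>c\<in>subspace_on p (W - {u}) \<inter> subspace_on p (W - {v}). bhv_dist p x c + bhv_dist p c y = bhv_dist p x y"
proof -
  have T: "x \<in> treespace p" "y \<in> treespace p" and xu: "x u = 0" and yv: "y v = 0"
    using x y unfolding subspace_on_def supp_def by auto
  let ?D = "bhv_dist p x y"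
  define G where "G m = bhv_dist p x m + bhv_dist p y m - ?D" for m
  have "\<exists>m\<in>subspace_on p (W - {u, v}). G m \<le> 0"
  proof (rule subspace_attains)
    show "\<bar>G m' - G m\<bar> \<le> 2 * bhv_dist p m' m" if "m \<in> treespace p" "m' \<in> treespace p" for m m'
      using bhv_Lipschitz[OF T(1) that] bhv_Lipschitz[OF T(2) that] unfolding G_def by linarith
    show "\<exists>m\<in>subspace_on p (W - {u, v}). bhv_dist p m (\<lambda>_. 0) \<le> ?D + 1 + bhv_dist p x (\<lambda>_. 0) \<and> G m \<le> \<epsilon>"
      if "\<epsilon> > 0" for \<epsilon>
    proof -
      define e where "e = min \<epsilon> 1"
      have e: "e > 0" "e \<le> \<epsilon>" "e \<le> 1" using that unfolding e_def by auto
      obtain L where L: "tpath p x y L" "L < ?D + e" using path_approx[OF T e(1)] by blast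
      obtain c K K' where c: "tpath p x c K" "tpath p c y K'" "K + K' = L" "c u = 0" "c v = 0"
        using path_cross[OF uv L(1) xu yv] by blast
      have cT: "c \<in> treespace p" using path_treespace c by blast
      let ?m = "proj W c"
      have mT: "?m \<in> treespace p" using proj_treespace cT by blast
      have mW: "?m \<in> subspace_on p (W - {u, v})"
        using mT c(4,5) unfolding subspace_on_def by (auto simp: supp_def proj_def)
      have xy: "x \<in> subspace_on p W" "y \<in> subspace_on p W" using x y unfolding subspace_on_def by auto
      have b: "bhv_dist p x ?m \<le> K" "bhv_dist p y ?m \<le> K'"
        using bhv_proj_le[OF T(1) cT, of W] bhv_proj_le[OF T(2) cT, of W]
          bhv_le_path[OF c(1)] bhv_le_path[OF c(2)] bhv_sym[of p c y]
        unfolding proj_id[OF xy(1)] proj_id[OF xy(2)] by linarith+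
      have K: "0 \<le> K" "0 \<le> K'" using path_nonneg c by blast+
      have "bhv_dist p ?m (\<lambda>_. 0) \<le> ?D + 1 + bhv_dist p x (\<lambda>_. 0)"
        using bhv_tri[OF mT T(1) zero_in_treespace] b K c(3) L(2) e(3) bhv_sym[of p x ?m] by linarith
      then show ?thesis using b c(3) L(2) e(2) mW unfolding G_def by (intro bexI[of _ ?m]) auto
    qed
  qed
  then obtain m where m: "m \<in> subspace_on p (W - {u, v})" "bhv_dist p x m + bhv_dist p m y \<le> ?D"
    unfolding G_def using bhv_sym[of p y] by auto
  have mT: "m \<in> treespace p" using m(1) unfolding subspace_on_def by simp
  have "m \<in> subspace_on p (W - {u}) \<inter> subspace_on p (W - {v})"
    using m(1) unfolding subspace_on_def by blast
  then show ?thesis using m(2) bhv_tri[OF T(1) mT T(2)] by (intro bexI[of _ m]) auto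
qed

lemma cat0_orthant:
  assumes W: "compat_set p W"
  shows "bhv.cat0 p (subspace_on p W)"
  unfolding bhv.cat0_def bhv.CN_def
proof (intro ballI allI impI)
  fix z x y t m
  assume zxy: "z \<in> subspace_on p W" "x \<in> subspace_on p W" "y \<in> subspace_on p W" and m: "bhv.dpt p x y t m"
  have mW: "m \<in> subspace_on p W" using bhv.gconvexD[OF gconvex_subspace] zxy m by blast
  have co: "bhv_dist p a b = eucl_dist p a b" if "a \<in> subspace_on p W" "b \<in> subspace_on p W" for a b
  proof -
    have "supp a \<union> supp b \<subseteq> W" using that unfolding subspace_on_def by blast
    then have "common_orthant p a b"
      using that compat_set_subset[OF W] unfolding common_orthant_iff subspace_on_def treespace_iff by blast
    then show ?thesis by (rule bhv_eq_eucl)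
  qed
  let ?e = "affine_comb x y t"
  have mx: "eucl_dist p m x = t * eucl_dist p x y" and my: "eucl_dist p m y = (1 - t) * eucl_dist p x y"
    using m co zxy mW eucl_dist_sym[of p m x] unfolding bhv.dpt_def by auto
  have "(eucl_dist p m ?e)\<^sup>2 = 0"
    unfolding eucl_dist_affine_comb mx my by (simp add: algebra_simps power2_eq_square)
  then have "eucl_dist p z m \<le> eucl_dist p z ?e"
    using eucl_dist_tri[of p z m ?e] eucl_dist_sym[of p m ?e] by simp
  then have "(eucl_dist p z m)\<^sup>2 \<le> (eucl_dist p z ?e)\<^sup>2"
    by (intro power_mono eucl_dist_nonneg)
  then show "(bhv_dist p z m)\<^sup>2 \<le> (1 - t) * (bhv_dist p z x)\<^sup>2 + t * (bhv_dist p z y)\<^sup>2 - t * (1 - t) * (bhv_dist p x y)\<^sup>2"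
    unfolding eucl_dist_affine_comb using co zxy mW by simp
qed

lemma cat0_subspace: "finite W \<Longrightarrow> W \<subseteq> clades p \<Longrightarrow> bhv.cat0 p (subspace_on p W)"
proof (induction W rule: finite_psubset_induct)
  case (psubset W)
  show ?case
  proof (cases "compat_set p W")
    case True
    then show ?thesis by (rule cat0_orthant)
  next
    case False
    then obtain u v where uv: "u \<in> W" "v \<in> W" "\<not> compatible u v"
      using psubset.prems unfolding compat_set_def by blast
    have un: "subspace_on p W = subspace_on p (W - {u}) \<union> subspace_on p (W - {v})"
    proof (intro equalityI subsetI)
      fix w assume w: "w \<in> subspace_on p W"
      then have "\<not> (u \<in> supp w \<and> v \<in> supp w)"
        using uv(3) unfolding subspace_on_def treespace_iff compat_set_def by blast
      then show "w \<in> subspace_on p (W - {u}) \<union> subspace_on p (W - {v})"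
        using w unfolding subspace_on_def by blast
    qed (auto simp: subspace_on_def)
    have "bhv.cat0 p (subspace_on p (W - {u}))" "bhv.cat0 p (subspace_on p (W - {v}))"
      using psubset.IH[of "W - {u}"] psubset.IH[of "W - {v}"] psubset.prems uv by blast+
    moreover have "bhv.gconvex p (subspace_on p (W - {u}) \<union> subspace_on p (W - {v}))"
      using gconvex_subspace[of p W] unfolding un .
    ultimately show ?thesis
      unfolding un using subspace_cross[OF uv(3)] by (intro bhv.cat0_Un gconvex_subspace)
  qed
qed

theorem treespace_cat0: "bhv.cat0 p (treespace p)"
proof -
  have "subspace_on p (clades p) = treespace p"
    unfolding subspace_on_def by (auto simp: treespace_iff compat_set_def)
  then show ?thesis using cat0_subspace[OF finite_clades order_refl] by metis
qed

subsection \<open>Log-concave functions and distances to convex sets\<close>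

definition log_conc :: "nat \<Rightarrow> (tree \<Rightarrow> real) \<Rightarrow> bool" where
  "log_conc p g \<longleftrightarrow> (\<forall>x\<in>treespace p. \<forall>y\<in>treespace p. \<forall>t m. bhv.dpt p x y t m \<longrightarrow> 0 < g x \<longrightarrow> 0 < g y \<longrightarrow>
     0 < g m \<and> (1 - t) * ln (g x) + t * ln (g y) \<le> ln (g m))"

lemma log_concD:
  "log_conc p g \<Longrightarrow> x \<in> treespace p \<Longrightarrow> y \<in> treespace p \<Longrightarrow> bhv.dpt p x y t m \<Longrightarrow> 0 < g x \<Longrightarrow> 0 < g y \<Longrightarrow>
     0 < g m \<and> (1 - t) * ln (g x) + t * ln (g y) \<le> ln (g m)"
  unfolding log_conc_def by blast

lemma ereal_le_elog: "0 \<le> r \<Longrightarrow> ereal \<mu> \<le> elog r \<longleftrightarrow> 0 < r \<and> \<mu> \<le> ln r"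
  unfolding elog_def by auto

text \<open>Equality in the Cauchy--Schwarz inequality forces both factors to be proportional.\<close>
lemma product_split:
  fixes A1 A2 B1 B2 D1 D2 t :: real
  assumes t: "0 \<le> t" "t \<le> 1" and nonneg: "0 \<le> A1" "0 \<le> A2" "0 \<le> B1" "0 \<le> B2" "0 \<le> D1" "0 \<le> D2"
    and tri: "D1 \<le> A1 + B1" "D2 \<le> A2 + B2"
    and A: "A1\<^sup>2 + A2\<^sup>2 = t\<^sup>2 * (D1\<^sup>2 + D2\<^sup>2)" and B: "B1\<^sup>2 + B2\<^sup>2 = (1 - t)\<^sup>2 * (D1\<^sup>2 + D2\<^sup>2)"
  shows "A1 = t * D1" "B1 = (1 - t) * D1" "A2 = t * D2" "B2 = (1 - t) * D2"
proof -
  have "(A1 - t * D1)\<^sup>2 + (B1 - (1 - t) * D1)\<^sup>2 + (A2 - t * D2)\<^sup>2 + (B2 - (1 - t) * D2)\<^sup>2 \<le> 0"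
  proof -
    define E where "E = D1\<^sup>2 + D2\<^sup>2"
    have "D1\<^sup>2 \<le> D1 * (A1 + B1)" "D2\<^sup>2 \<le> D2 * (A2 + B2)"
      using tri nonneg by (auto simp: power2_eq_square intro!: mult_left_mono)
    then have s: "E \<le> (D1 * A1 + D2 * A2) + (D1 * B1 + D2 * B2)"
      unfolding E_def by (simp add: algebra_simps)
    have cs: "D1 * a + D2 * b \<le> s * E"
      if "a\<^sup>2 + b\<^sup>2 = s\<^sup>2 * E" "0 \<le> s" for a b s
    proof -
      have "(D1 * a + D2 * b)\<^sup>2 \<le> (D1\<^sup>2 + D2\<^sup>2) * (a\<^sup>2 + b\<^sup>2)"
        using zero_le_power2[of "D1 * b - D2 * a"] by (simp add: power2_eq_square algebra_simps)
      also have "\<dots> = (s * E)\<^sup>2" unfolding that(1) E_def by (simp add: power2_eq_square algebra_simps)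
      finally show ?thesis
      proof (rule power2_le_imp_le)
        show "0 \<le> s * E" using that(2) unfolding E_def by simp
      qed
    qed
    have ca: "D1 * A1 + D2 * A2 \<le> t * E" and cb: "D1 * B1 + D2 * B2 \<le> (1 - t) * E"
      using cs[of A1 A2 t] cs[of B1 B2 "1 - t"] A B t unfolding E_def by auto
    have e1: "D1 * A1 + D2 * A2 = t * E" and e2: "D1 * B1 + D2 * B2 = (1 - t) * E"
      using s ca cb by (auto simp: algebra_simps)
    have "(A1 - t * D1)\<^sup>2 + (A2 - t * D2)\<^sup>2 = (A1\<^sup>2 + A2\<^sup>2) - 2 * t * (D1 * A1 + D2 * A2) + t\<^sup>2 * E"
      unfolding E_def by (simp add: power2_eq_square algebra_simps)
    also have "\<dots> = 0" unfolding A e1 E_def by (simp add: power2_eq_square algebra_simps)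
    finally have f1: "(A1 - t * D1)\<^sup>2 + (A2 - t * D2)\<^sup>2 = 0" .
    have "(B1 - (1 - t) * D1)\<^sup>2 + (B2 - (1 - t) * D2)\<^sup>2 = (B1\<^sup>2 + B2\<^sup>2) - 2 * (1 - t) * (D1 * B1 + D2 * B2) + (1 - t)\<^sup>2 * E"
      unfolding E_def by (simp add: power2_eq_square algebra_simps)
    also have "\<dots> = 0" unfolding B e2 E_def by (simp add: power2_eq_square algebra_simps)
    finally show ?thesis using f1 by linarith
  qed
  then have "(A1 - t * D1)\<^sup>2 = 0" "(B1 - (1 - t) * D1)\<^sup>2 = 0" "(A2 - t * D2)\<^sup>2 = 0" "(B2 - (1 - t) * D2)\<^sup>2 = 0"
    by (smt (verit) zero_le_power2)+
  then show "A1 = t * D1" "B1 = (1 - t) * D1" "A2 = t * D2" "B2 = (1 - t) * D2" by auto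
qed

lemma product_geodesic:
  assumes \<gamma>: "geodesic (treespace p \<times> UNIV) (prod_dist p) a b \<gamma>" and t: "t \<in> {0..1}"
    and a: "fst a \<in> treespace p" and b: "fst b \<in> treespace p"
  shows "bhv.dpt p (fst a) (fst b) t (fst (\<gamma> t))" "snd (\<gamma> t) = (1 - t) * snd a + t * snd b"
proof -
  let ?m = "fst (\<gamma> t)"
  have m: "?m \<in> treespace p" using \<gamma> t unfolding geodesic_def by (metis mem_Times_iff)
  have ab: "\<gamma> 0 = a" "\<gamma> 1 = b" using \<gamma> unfolding geodesic_def by auto
  have "prod_dist p (\<gamma> 0) (\<gamma> t) = \<bar>0 - t\<bar> * prod_dist p a b"
    "prod_dist p (\<gamma> t) (\<gamma> 1) = \<bar>t - 1\<bar> * prod_dist p a b"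
    using \<gamma> t unfolding geodesic_def by (metis atLeastAtMost_iff order_refl zero_le_one)+
  then have "(prod_dist p a (\<gamma> t))\<^sup>2 = t\<^sup>2 * (prod_dist p a b)\<^sup>2"
    "(prod_dist p (\<gamma> t) b)\<^sup>2 = (1 - t)\<^sup>2 * (prod_dist p a b)\<^sup>2"
    using ab t by (auto simp: power_mult_distrib)
  then have A: "(bhv_dist p (fst a) ?m)\<^sup>2 + \<bar>snd a - snd (\<gamma> t)\<bar>\<^sup>2 = t\<^sup>2 * ((bhv_dist p (fst a) (fst b))\<^sup>2 + \<bar>snd a - snd b\<bar>\<^sup>2)"
    and B: "(bhv_dist p ?m (fst b))\<^sup>2 + \<bar>snd (\<gamma> t) - snd b\<bar>\<^sup>2 = (1 - t)\<^sup>2 * ((bhv_dist p (fst a) (fst b))\<^sup>2 + \<bar>snd a - snd b\<bar>\<^sup>2)"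
    unfolding prod_dist_def by simp_all
  have t': "0 \<le> t" "t \<le> 1" using t by auto
  note * = product_split[OF t' bhv_nonneg[OF a m] abs_ge_zero bhv_nonneg[OF m b] abs_ge_zero bhv_nonneg[OF a b] abs_ge_zero
      bhv_tri[OF a m b] _ A B]
  have tri: "\<bar>snd a - snd b\<bar> \<le> \<bar>snd a - snd (\<gamma> t)\<bar> + \<bar>snd (\<gamma> t) - snd b\<bar>" by linarith
  show "bhv.dpt p (fst a) (fst b) t ?m"
    unfolding bhv.dpt_def using *(1,2)[OF tri] t' m by blast
  have "\<bar>snd a - snd (\<gamma> t)\<bar> = t * \<bar>snd a - snd b\<bar>" "\<bar>snd (\<gamma> t) - snd b\<bar> = (1 - t) * \<bar>snd a - snd b\<bar>"
    using *(3,4)[OF tri] by blast+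
  then show "snd (\<gamma> t) = (1 - t) * snd a + t * snd b"
    by (cases "snd a \<le> snd b") (auto simp: abs_if algebra_simps split: if_splits)
qed

lemma log_conc_imp_log_concave:
  assumes nonneg: "\<forall>x\<in>treespace p. 0 \<le> g x" and g: "log_conc p g"
  shows "log_concave p g"
  unfolding log_concave_def concave_tree_def
proof (intro ballI allI impI)
  fix a b \<gamma> t
  assume a: "a \<in> hypograph p (\<lambda>x. elog (g x))" and b: "b \<in> hypograph p (\<lambda>x. elog (g x))"
    and \<gamma>: "geodesic (treespace p \<times> UNIV) (prod_dist p) a b \<gamma>" and t: "t \<in> {0..1::real}"
  have aT: "fst a \<in> treespace p" "0 < g (fst a)" "snd a \<le> ln (g (fst a))"
    and bT: "fst b \<in> treespace p" "0 < g (fst b)" "snd b \<le> ln (g (fst b))"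
    using a b nonneg ereal_le_elog unfolding hypograph_def by auto
  note m = product_geodesic[OF \<gamma> t aT(1) bT(1)]
  have mT: "fst (\<gamma> t) \<in> treespace p" using m(1) unfolding bhv.dpt_def by blast
  have l: "0 < g (fst (\<gamma> t))" "(1 - t) * ln (g (fst a)) + t * ln (g (fst b)) \<le> ln (g (fst (\<gamma> t)))"
    using log_concD[OF g aT(1) bT(1) m(1) aT(2) bT(2)] by auto
  have "(1 - t) * snd a + t * snd b \<le> (1 - t) * ln (g (fst a)) + t * ln (g (fst b))"
    using aT bT t by (intro add_mono mult_left_mono) auto
  then have "ereal (snd (\<gamma> t)) \<le> elog (g (fst (\<gamma> t)))"
    using l m(2) by (subst ereal_le_elog) auto
  then show "\<gamma> t \<in> hypograph p (\<lambda>x. elog (g x))"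
    using mT unfolding hypograph_def by (simp add: case_prod_beta)
qed

lemma log_concave_imp_log_conc:
  assumes nonneg: "\<forall>x\<in>treespace p. 0 \<le> g x" and g: "log_concave p g"
  shows "log_conc p g"
  unfolding log_conc_def
proof (intro ballI allI impI)
  fix x y t m
  assume x: "x \<in> treespace p" and y: "y \<in> treespace p" and m: "bhv.dpt p x y t m" and gx: "0 < g x" and gy: "0 < g y"
  obtain \<gamma> where \<gamma>: "geodesic (treespace p) (bhv_dist p) x y \<gamma>" "\<gamma> t = m"
    using bhv.cat0_geodesic_through[OF treespace_cat0 x y m] by blast
  define \<Gamma> where "\<Gamma> s = (\<gamma> s, (1 - s) * ln (g x) + s * ln (g y))" for s
  let ?a = "(x, ln (g x))" and ?b = "(y, ln (g y))"
  have "?a \<in> hypograph p (\<lambda>x. elog (g x))" "?b \<in> hypograph p (\<lambda>x. elog (g x))"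
    using x y gx gy unfolding hypograph_def by (auto simp: ereal_le_elog)
  moreover have "geodesic (treespace p \<times> UNIV) (prod_dist p) ?a ?b \<Gamma>"
    unfolding geodesic_def
  proof (intro conjI ballI)
    show "\<Gamma> 0 = ?a" "\<Gamma> 1 = ?b" using \<gamma> unfolding \<Gamma>_def geodesic_def by auto
    show "\<Gamma> s \<in> treespace p \<times> UNIV" if "s \<in> {0..1}" for s using \<gamma>(1) that unfolding \<Gamma>_def geodesic_def by auto
    fix s r :: real assume "s \<in> {0..1}" "r \<in> {0..1}"
    then have "bhv_dist p (\<gamma> s) (\<gamma> r) = \<bar>s - r\<bar> * bhv_dist p x y" using \<gamma>(1) unfolding geodesic_def by blast
    moreover have "((1 - s) * ln (g x) + s * ln (g y)) - ((1 - r) * ln (g x) + r * ln (g y)) = (r - s) * (ln (g x) - ln (g y))"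
      by (simp add: algebra_simps)
    moreover have "(\<bar>s - r\<bar> * bhv_dist p x y)\<^sup>2 + ((r - s) * (ln (g x) - ln (g y)))\<^sup>2
      = \<bar>s - r\<bar>\<^sup>2 * ((bhv_dist p x y)\<^sup>2 + (ln (g x) - ln (g y))\<^sup>2)"
      by (simp add: power_mult_distrib power2_commute[of r s] distrib_left)
    ultimately show "prod_dist p (\<Gamma> s) (\<Gamma> r) = \<bar>s - r\<bar> * prod_dist p ?a ?b"
      unfolding prod_dist_def \<Gamma>_def by (simp add: real_sqrt_mult)
  qed
  moreover have "t \<in> {0..1}" using m unfolding bhv.dpt_def by simp
  ultimately have "\<Gamma> t \<in> hypograph p (\<lambda>x. elog (g x))"
    using g unfolding log_concave_def concave_tree_def by blast
  then have "m \<in> treespace p" "ereal ((1 - t) * ln (g x) + t * ln (g y)) \<le> elog (g m)"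
    unfolding \<Gamma>_def hypograph_def \<gamma>(2) by auto
  then show "0 < g m \<and> (1 - t) * ln (g x) + t * ln (g y) \<le> ln (g m)"
    using ereal_le_elog nonneg by blast
qed

lemma log_conc_mult:
  assumes "log_conc p g" "log_conc p h" "\<forall>x\<in>treespace p. 0 \<le> g x" "\<forall>x\<in>treespace p. 0 \<le> h x"
  shows "log_conc p (\<lambda>x. g x * h x)"
  unfolding log_conc_def
proof (intro ballI allI impI)
  fix x y t m
  assume x: "x \<in> treespace p" and y: "y \<in> treespace p" and m: "bhv.dpt p x y t m"
    and gx: "0 < g x * h x" and gy: "0 < g y * h y"
  have pos: "0 < g x" "0 < h x" "0 < g y" "0 < h y"
    using gx gy assms(3,4) x y by (metis less_eq_real_def mult_eq_0_iff order_less_irrefl)+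
  note G = log_concD[OF assms(1) x y m pos(1,3)] and H = log_concD[OF assms(2) x y m pos(2,4)]
  show "0 < g m * h m \<and> (1 - t) * ln (g x * h x) + t * ln (g y * h y) \<le> ln (g m * h m)"
    using G H pos by (auto simp: ln_mult_pos algebra_simps)
qed

lemma log_conc_sqrt:
  assumes "log_conc p g"
  shows "log_conc p (\<lambda>x. sqrt (g x))"
  unfolding log_conc_def
proof (intro ballI allI impI)
  fix x y t m
  assume x: "x \<in> treespace p" and y: "y \<in> treespace p" and m: "bhv.dpt p x y t m"
    and gx: "0 < sqrt (g x)" and gy: "0 < sqrt (g y)"
  then have pos: "0 < g x" "0 < g y" by auto
  then show "0 < sqrt (g m) \<and> (1 - t) * ln (sqrt (g x)) + t * ln (sqrt (g y)) \<le> ln (sqrt (g m))"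
    using log_concD[OF assms x y m pos] by (simp add: ln_sqrt field_simps)
qed

lemma log_conc_const: "0 < c \<Longrightarrow> log_conc p (\<lambda>_. c)"
  unfolding log_conc_def by (auto simp: algebra_simps)

lemma usc_tree_mult:
  assumes "usc_tree p g" "usc_tree p h" "\<forall>x\<in>treespace p. 0 \<le> g x" "\<forall>x\<in>treespace p. 0 \<le> h x"
  shows "usc_tree p (\<lambda>x. g x * h x)"
  unfolding usc_tree_def
proof (intro ballI allI impI)
  fix x c assume x: "x \<in> treespace p" and c: "g x * h x < c"
  have "((\<lambda>\<delta>. (g x + \<delta>) * (h x + \<delta>)) \<longlongrightarrow> (g x + 0) * (h x + 0)) (at_right 0)"
    by (intro tendsto_intros)
  then have "eventually (\<lambda>\<delta>. (g x + \<delta>) * (h x + \<delta>) < c) (at_right 0)"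
    using c by (intro order_tendstoD(2)) auto
  moreover have "eventually (\<lambda>\<delta>::real. 0 < \<delta>) (at_right 0)"
    by (simp add: eventually_at_right_less)
  ultimately obtain \<delta> where \<delta>: "0 < \<delta>" "(g x + \<delta>) * (h x + \<delta>) < c"
    using eventually_happens'[OF trivial_limit_at_right_real eventually_conj[of "\<lambda>\<delta>. (g x + \<delta>) * (h x + \<delta>) < c"]]
    by blast
  obtain e1 where e1: "e1 > 0" "\<forall>y\<in>treespace p. bhv_dist p x y < e1 \<longrightarrow> g y < g x + \<delta>"
    using assms(1) x \<delta>(1) unfolding usc_tree_def by (metis less_add_same_cancel1)
  obtain e2 where e2: "e2 > 0" "\<forall>y\<in>treespace p. bhv_dist p x y < e2 \<longrightarrow> h y < h x + \<delta>"
    using assms(2) x \<delta>(1) unfolding usc_tree_def by (metis less_add_same_cancel1)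
  have "g y * h y < c" if y: "y \<in> treespace p" "bhv_dist p x y < min e1 e2" for y
  proof -
    have "g y * h y \<le> (g x + \<delta>) * (h x + \<delta>)"
      using e1 e2 y assms(3,4) x \<delta>(1) by (intro mult_mono) (auto simp: less_imp_le add_nonneg_nonneg)
    then show ?thesis using \<delta>(2) by linarith
  qed
  then show "\<exists>e>0. \<forall>y\<in>treespace p. bhv_dist p x y < e \<longrightarrow> g y * h y < c"
    using e1(1) e2(1) by (metis min_less_iff_conj)
qed

lemma usc_tree_sqrt:
  assumes "usc_tree p g" "\<forall>x\<in>treespace p. 0 \<le> g x"
  shows "usc_tree p (\<lambda>x. sqrt (g x))"
  unfolding usc_tree_def
proof (intro ballI allI impI)
  fix x c assume x: "x \<in> treespace p" and c: "sqrt (g x) < c"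
  have c0: "0 < c" using c assms(2) x by (meson order_le_less_trans real_sqrt_ge_zero)
  have "g x < c\<^sup>2" using c c0 by (metis real_less_rsqrt real_sqrt_less_iff real_sqrt_unique less_imp_le)
  then obtain e where e: "e > 0" "\<forall>y\<in>treespace p. bhv_dist p x y < e \<longrightarrow> g y < c\<^sup>2"
    using assms(1) x unfolding usc_tree_def by blast
  then show "\<exists>e>0. \<forall>y\<in>treespace p. bhv_dist p x y < e \<longrightarrow> sqrt (g y) < c"
    using c0 by (intro exI[of _ e]) (auto intro!: real_less_lsqrt assms(2)[rule_format])
qed

definition set_dist :: "nat \<Rightarrow> tree set \<Rightarrow> tree \<Rightarrow> real" where
  "set_dist p K x = (INF k\<in>K. bhv_dist p x k)"

context
  fixes p :: nat and K :: "tree set"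
  assumes K: "K \<subseteq> treespace p" "K \<noteq> {}"
begin

lemma set_dist_bdd: "x \<in> treespace p \<Longrightarrow> bdd_below (bhv_dist p x ` K)"
  using K bhv_nonneg by (intro bdd_belowI[of _ 0]) auto

lemma set_dist_le: "x \<in> treespace p \<Longrightarrow> k \<in> K \<Longrightarrow> set_dist p K x \<le> bhv_dist p x k"
  unfolding set_dist_def using set_dist_bdd by (intro cINF_lower)

lemma set_dist_nonneg: "x \<in> treespace p \<Longrightarrow> 0 \<le> set_dist p K x"
  unfolding set_dist_def using K bhv_nonneg by (intro cINF_greatest) auto

lemma set_dist_approx: "x \<in> treespace p \<Longrightarrow> 0 < e \<Longrightarrow> \<exists>k\<in>K. bhv_dist p x k < set_dist p K x + e"
  using cINF_less_iff[OF K(2) set_dist_bdd, of x "set_dist p K x + e"] unfolding set_dist_def by simp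

lemma set_dist_zero: "x \<in> K \<Longrightarrow> set_dist p K x = 0"
  using set_dist_le[of x x] set_dist_nonneg[of x] K bhv_zero_iff[of x p x] by force

lemma set_dist_Lipschitz:
  assumes "x \<in> treespace p" "y \<in> treespace p"
  shows "set_dist p K x \<le> set_dist p K y + bhv_dist p x y"
proof (rule field_le_epsilon)
  fix e :: real assume "0 < e"
  then obtain k where k: "k \<in> K" "bhv_dist p y k < set_dist p K y + e" using set_dist_approx assms by blast
  then show "set_dist p K x \<le> set_dist p K y + bhv_dist p x y + e"
    using set_dist_le[OF assms(1) k(1)] bhv_tri[OF assms, of k] K by fastforce
qed

lemma set_dist_convex:
  assumes "bhv.gconvex p K" and x: "x \<in> treespace p" and y: "y \<in> treespace p" and m: "bhv.dpt p x y t m"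
  shows "set_dist p K m \<le> (1 - t) * set_dist p K x + t * set_dist p K y"
proof (rule field_le_epsilon)
  fix e :: real assume e: "0 < e"
  have t: "0 \<le> t" "t \<le> 1" "m \<in> treespace p" using m unfolding bhv.dpt_def by auto
  obtain k where k: "k \<in> K" "bhv_dist p x k < set_dist p K x + e" using set_dist_approx x e by blast
  obtain l where l: "l \<in> K" "bhv_dist p y l < set_dist p K y + e" using set_dist_approx y e by blast
  have kl: "k \<in> treespace p" "l \<in> treespace p" using k l K by auto
  obtain q where q: "bhv.dpt p k l t q" using bhv.dpt_exists[OF kl t(1,2)] by blast
  have "q \<in> K" using bhv.gconvexD[OF assms(1)] k l q by blast
  then have "set_dist p K m \<le> bhv_dist p m q" using set_dist_le t by blast
  also have "\<dots> \<le> (1 - t) * bhv_dist p x k + t * bhv_dist p y l"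
    using bhv.cat0_dist_convex[OF treespace_cat0 x y kl m q] .
  also have "\<dots> \<le> (1 - t) * (set_dist p K x + e) + t * (set_dist p K y + e)"
    using k l t by (intro add_mono mult_left_mono) auto
  finally show "set_dist p K m \<le> (1 - t) * set_dist p K x + t * set_dist p K y + e"
    by (simp add: algebra_simps)
qed

lemma log_conc_exp_set_dist:
  assumes "bhv.gconvex p K"
  shows "log_conc p (\<lambda>x. exp (- set_dist p K x))"
  unfolding log_conc_def using set_dist_convex[OF assms] by fastforce

lemma usc_exp_set_dist: "usc_tree p (\<lambda>x. exp (- set_dist p K x))"
  unfolding usc_tree_def
proof (intro ballI allI impI)
  fix x c assume x: "x \<in> treespace p" and c: "exp (- set_dist p K x) < c"
  have c0: "0 < c" using c exp_gt_zero order.strict_trans by blast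
  then have "- set_dist p K x < ln c" using c by (metis exp_less_cancel_iff exp_ln)
  moreover have "exp (- set_dist p K y) < c"
    if y: "y \<in> treespace p" "bhv_dist p x y < ln c + set_dist p K x" for y
  proof -
    have "- set_dist p K y < ln c" using set_dist_Lipschitz[OF x y(1)] y(2) by linarith
    then show ?thesis using c0 by (metis exp_less_cancel_iff exp_ln)
  qed
  ultimately show "\<exists>e>0. \<forall>y\<in>treespace p. bhv_dist p x y < e \<longrightarrow> exp (- set_dist p K y) < c"
    by (intro exI[of _ "ln c + set_dist p K x"]) auto
qed

end

lemma superlevel_gconvex:
  assumes "log_conc p g" "0 < c"
  shows "bhv.gconvex p {x \<in> treespace p. c \<le> g x}"
  unfolding bhv.gconvex_def
proof (intro conjI ballI allI impI)
  fix x y t m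
  assume x: "x \<in> {x \<in> treespace p. c \<le> g x}" and y: "y \<in> {x \<in> treespace p. c \<le> g x}" and m: "bhv.dpt p x y t m"
  have t: "0 \<le> t" "t \<le> 1" "m \<in> treespace p" using m unfolding bhv.dpt_def by auto
  have l: "0 < g m" "(1 - t) * ln (g x) + t * ln (g y) \<le> ln (g m)"
    using log_concD[OF assms(1) _ _ m] x y assms(2) by auto
  have "(1 - t) * ln c + t * ln c \<le> (1 - t) * ln (g x) + t * ln (g y)"
    using x y t assms(2) by (intro add_mono mult_left_mono) auto
  then have "ln c \<le> ln (g m)" using l by (simp add: algebra_simps)
  then show "m \<in> {x \<in> treespace p. c \<le> g x}" using t l assms(2) by simp
qed auto

lemma superlevel_closed:
  assumes "usc_tree p g" "x \<in> treespace p" "g x < c" "K \<subseteq> {x \<in> treespace p. c \<le> g x}" "K \<noteq> {}"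
  shows "0 < set_dist p K x"
proof -
  obtain e where e: "e > 0" "\<forall>y\<in>treespace p. bhv_dist p x y < e \<longrightarrow> g y < c"
    using assms(1-3) unfolding usc_tree_def by blast
  have "e \<le> set_dist p K x"
    unfolding set_dist_def
  proof (rule cINF_greatest)
    fix k assume "k \<in> K"
    then have "k \<in> treespace p" "\<not> g k < c" using assms(4) by auto
    then show "e \<le> bhv_dist p x k" using e(2) by force
  qed (rule assms(5))
  then show ?thesis using e(1) by linarith
qed

lemma log_conc_ball: "log_conc p (\<lambda>x. indicator {w. bhv_dist p (\<lambda>_. 0) w \<le> R} x)"
  unfolding log_conc_def
proof (intro ballI allI impI)
  fix x y t m
  assume x: "x \<in> treespace p" and y: "y \<in> treespace p" and m: "bhv.dpt p x y t m"
    and pos: "0 < (indicator {w. bhv_dist p (\<lambda>_. 0) w \<le> R} x :: real)" "0 < (indicator {w. bhv_dist p (\<lambda>_. 0) w \<le> R} y :: real)"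
  then have "bhv_dist p (\<lambda>_. 0) x \<le> R" "bhv_dist p (\<lambda>_. 0) y \<le> R" by (auto simp: indicator_def split: if_splits)
  then have "bhv_dist p (\<lambda>_. 0) m \<le> R"
    using bhv.cat0_ball_convex[OF treespace_cat0 zero_in_treespace x y m] by blast
  then show "0 < (indicator {w. bhv_dist p (\<lambda>_. 0) w \<le> R} m :: real) \<and>
     (1 - t) * ln (indicator {w. bhv_dist p (\<lambda>_. 0) w \<le> R} x) + t * ln (indicator {w. bhv_dist p (\<lambda>_. 0) w \<le> R} y)
      \<le> ln (indicator {w. bhv_dist p (\<lambda>_. 0) w \<le> R} m :: real)"
    by (auto simp: indicator_def)
qed

lemma usc_ball: "usc_tree p (\<lambda>x. indicator {w. bhv_dist p (\<lambda>_. 0) w \<le> R} x)"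
  unfolding usc_tree_def
proof (intro ballI allI impI)
  fix x and c :: real
  assume x: "x \<in> treespace p" and c: "indicator {w. bhv_dist p (\<lambda>_. 0) w \<le> R} x < c"
  let ?d = "bhv_dist p (\<lambda>_. 0)"
  show "\<exists>e>0. \<forall>y\<in>treespace p. bhv_dist p x y < e \<longrightarrow> indicator {w. ?d w \<le> R} y < c"
  proof (cases "?d x \<le> R")
    case True
    then have "1 < c" using c by simp
    then have "\<forall>y\<in>treespace p. bhv_dist p x y < 1 \<longrightarrow> indicator {w. ?d w \<le> R} y < c"
      by (auto simp: indicator_def)
    then show ?thesis by (intro exI[of _ 1]) auto
  next
    case False
    have "\<not> ?d y \<le> R" if "y \<in> treespace p" "bhv_dist p x y < ?d x - R" for y
      using bhv_tri[OF zero_in_treespace that(1) x] that(2) bhv_sym[of p x y] by linarith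
    then show ?thesis using False c by (intro exI[of _ "?d x - R"]) (auto simp: indicator_def)
  qed
qed

subsection \<open>The measure on tree space\<close>

lemma topology_finite: "C \<in> topologies p \<Longrightarrow> finite C"
  using finite_clades finite_subset unfolding topologies_def by blast

lemma emb_orthant: "(\<forall>S\<in>C. 0 < x S) \<Longrightarrow> emb C x \<in> orthant p C"
  unfolding orthant_def emb_def by (auto simp: less_imp_le)

lemma emb_treespace: "C \<in> topologies p \<Longrightarrow> (\<forall>S\<in>C. 0 < x S) \<Longrightarrow> emb C x \<in> treespace p"
  using emb_orthant unfolding treespace_def by blast

lemma component_borel_measurable: "S \<in> C \<Longrightarrow> (\<lambda>x. x S) \<in> borel_measurable (PiM C (\<lambda>_. lborel :: real measure))"
  using measurable_component_singleton[of S C "\<lambda>_. lborel :: real measure"] by simp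

lemma open_part_treespace_measurable:
  assumes C: "C \<in> topologies p"
  shows "open_part C (treespace p) \<in> sets (PiM C (\<lambda>_. lborel))"
proof -
  have "open_part C (treespace p) = {x \<in> space (PiM C (\<lambda>_. lborel)). \<forall>S\<in>C. 0 < x S}"
    unfolding open_part_def using emb_treespace[OF C] by blast
  also have "\<dots> \<in> sets (PiM C (\<lambda>_. lborel))"
    using topology_finite[OF C] component_borel_measurable
    by (intro sets.sets_Collect_finite_All) (auto intro!: borel_measurable_less)
  finally show ?thesis .
qed

lemma nu_sets_sigma_algebra: "sigma_algebra (treespace p) (nu_sets p)"
  unfolding sigma_algebra_iff2
proof (intro conjI ballI allI impI)
  show "nu_sets p \<subseteq> Pow (treespace p)" unfolding nu_sets_def by blast
  show "{} \<in> nu_sets p" unfolding nu_sets_def open_part_def by auto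
  fix A assume A: "A \<in> nu_sets p"
  have "open_part C (treespace p - A) = open_part C (treespace p) - open_part C A" for C
    unfolding open_part_def by blast
  then show "treespace p - A \<in> nu_sets p"
    using A open_part_treespace_measurable unfolding nu_sets_def by auto
next
  fix A :: "nat \<Rightarrow> tree set" assume A: "range A \<subseteq> nu_sets p"
  have "open_part C (\<Union>i. A i) = (\<Union>i. open_part C (A i))" for C
    unfolding open_part_def by blast
  then show "(\<Union>i. A i) \<in> nu_sets p"
    using A unfolding nu_sets_def by (fastforce intro: sets.countable_UN)
qed

lemma sets_nu0: "sets (nu0 p) = nu_sets p"
  unfolding nu0_def using nu_sets_sigma_algebra sigma_algebra.sets_measure_of_eq by blast

lemma space_nu0: "space (nu0 p) = treespace p"
  unfolding nu0_def by (rule space_measure_of) (auto simp: nu_sets_def)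

lemma space_nu: "space (nu p) = treespace p"
  unfolding nu_def by (simp add: space_nu0)

lemma emeasure_nu0:
  assumes "A \<in> nu_sets p"
  shows "emeasure (nu0 p) A = (\<Sum>C\<in>topologies p. emeasure (PiM C (\<lambda>_. lborel)) (open_part C A))"
  unfolding nu0_def
proof (rule emeasure_measure_of_sigma[OF nu_sets_sigma_algebra _ _ assms])
  show "positive (nu_sets p) (\<lambda>A. \<Sum>C\<in>topologies p. emeasure (PiM C (\<lambda>_. lborel)) (open_part C A))"
    unfolding positive_def open_part_def by simp
  show "countably_additive (nu_sets p) (\<lambda>A. \<Sum>C\<in>topologies p. emeasure (PiM C (\<lambda>_. lborel)) (open_part C A))"
  proof (rule countably_additiveI)
    fix A :: "nat \<Rightarrow> tree set"
    assume A: "range A \<subseteq> nu_sets p" "disjoint_family A"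
    have "(\<Sum>i. \<Sum>C\<in>topologies p. emeasure (PiM C (\<lambda>_. lborel)) (open_part C (A i)))
      = (\<Sum>C\<in>topologies p. \<Sum>i. emeasure (PiM C (\<lambda>_. lborel)) (open_part C (A i)))"
      by (intro suminf_sum summableI)
    also have "\<dots> = (\<Sum>C\<in>topologies p. emeasure (PiM C (\<lambda>_. lborel)) (open_part C (\<Union>i. A i)))"
    proof (rule sum.cong[OF refl])
      fix C assume C: "C \<in> topologies p"
      have "range (\<lambda>i. open_part C (A i)) \<subseteq> sets (PiM C (\<lambda>_. lborel))"
        using A(1) C unfolding nu_sets_def by blast
      moreover have "disjoint_family (\<lambda>i. open_part C (A i))"
        using A(2) unfolding disjoint_family_on_def open_part_def by blast
      moreover have "open_part C (\<Union>i. A i) = (\<Union>i. open_part C (A i))"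
        unfolding open_part_def by blast
      ultimately show "(\<Sum>i. emeasure (PiM C (\<lambda>_. lborel)) (open_part C (A i))) = emeasure (PiM C (\<lambda>_. lborel)) (open_part C (\<Union>i. A i))"
        by (simp add: suminf_emeasure)
    qed
    finally show "(\<Sum>i. \<Sum>C\<in>topologies p. emeasure (PiM C (\<lambda>_. lborel)) (open_part C (A i)))
      = (\<Sum>C\<in>topologies p. emeasure (PiM C (\<lambda>_. lborel)) (open_part C (\<Union>i. A i)))" .
  qed
qed

lemma eucl_dist_emb_measurable:
  "(\<lambda>x. eucl_dist p (emb C x) w) \<in> borel_measurable (PiM C (\<lambda>_. lborel))"
proof -
  have "(\<lambda>x. emb C x S) \<in> borel_measurable (PiM C (\<lambda>_. lborel))" for S
    unfolding emb_def using component_borel_measurable by (cases "S \<in> C") auto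
  note [measurable] = this
  show ?thesis unfolding eucl_dist_def by measurable
qed

lemma rational_approx:
  assumes C: "C \<in> topologies p" and x: "\<forall>S\<in>C. 0 < x S" and \<delta>: "0 < \<delta>"
  shows "\<exists>q\<in>(\<Pi>\<^sub>E S\<in>C. {r \<in> \<rat>. 0 < r}). eucl_dist p (emb C x) (emb C q) < \<delta>"
proof -
  define \<eta> where "\<eta> = \<delta> / (card (clades p) + 1)"
  have \<eta>: "0 < \<eta>" using \<delta> unfolding \<eta>_def by simp
  have "\<forall>S. \<exists>r\<in>\<rat>. x S < r \<and> r < x S + \<eta>" using \<eta> Rats_dense_in_real by simp
  then obtain r where r: "\<And>S. r S \<in> \<rat>" "\<And>S. x S < r S" "\<And>S. r S < x S + \<eta>" by metis
  define q where "q = restrict r C"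
  have "q \<in> (\<Pi>\<^sub>E S\<in>C. {r \<in> \<rat>. 0 < r})"
    unfolding q_def using r x by (auto intro: less_trans)
  moreover have "eucl_dist p (emb C x) (emb C q) < \<delta>"
  proof -
    have "eucl_dist p (emb C x) (emb C q) \<le> (\<Sum>S\<in>clades p. \<bar>emb C x S - emb C q S\<bar>)"
      unfolding eucl_dist_L2 by (rule L2_set_le_sum_abs)
    also have "\<dots> \<le> (\<Sum>S\<in>clades p. \<eta>)"
    proof (rule sum_mono)
      fix S
      show "\<bar>emb C x S - emb C q S\<bar> \<le> \<eta>"
        unfolding emb_def q_def using r(2)[of S] r(3)[of S] \<eta> by auto
    qed
    also have "\<dots> = card (clades p) * \<eta>" by simp
    also have "\<dots> < \<delta>" unfolding \<eta>_def using \<delta> by (simp add: field_simps)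
    finally show ?thesis .
  qed
  ultimately show ?thesis by blast
qed

lemma Lipschitz_measurable:
  assumes Lip: "\<And>x y. x \<in> treespace p \<Longrightarrow> y \<in> treespace p \<Longrightarrow> \<phi> x \<le> \<phi> y + bhv_dist p x y"
  shows "\<phi> \<in> borel_measurable (nu0 p)"
proof (rule borel_measurableI_less)
  fix a :: real
  have "open_part C {x \<in> treespace p. \<phi> x < a} \<in> sets (PiM C (\<lambda>_. lborel))" if C: "C \<in> topologies p" for C
  proof -
    let ?M = "PiM C (\<lambda>_. lborel :: real measure)" and ?Q = "\<Pi>\<^sub>E S\<in>C. {r \<in> \<rat>. 0 < r} :: real set"
    have d: "bhv_dist p (emb C x) (emb C q) = eucl_dist p (emb C x) (emb C q)"
      if "\<forall>S\<in>C. 0 < x S" "\<forall>S\<in>C. 0 < q S" for x q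
      using emb_orthant that C by (intro bhv_eq_eucl) (auto simp: common_orthant_def)
    have "open_part C {x \<in> treespace p. \<phi> x < a} = open_part C (treespace p) \<inter>
      (\<Union>q\<in>?Q. {x \<in> space ?M. \<phi> (emb C q) + eucl_dist p (emb C x) (emb C q) < a})" (is "?l = ?r")
    proof (intro equalityI subsetI)
      fix x assume x: "x \<in> ?l"
      then have xs: "x \<in> space ?M" "\<forall>S\<in>C. 0 < x S" "\<phi> (emb C x) < a" unfolding open_part_def by auto
      then obtain q where q: "q \<in> ?Q" "eucl_dist p (emb C x) (emb C q) < (a - \<phi> (emb C x)) / 2"
        using rational_approx[OF C xs(2), of "(a - \<phi> (emb C x)) / 2"] by auto
      have q0: "\<forall>S\<in>C. 0 < q S" using q(1) by (auto simp: PiE_iff)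
      have "\<phi> (emb C q) \<le> \<phi> (emb C x) + eucl_dist p (emb C x) (emb C q)"
        using Lip[OF emb_treespace[OF C q0] emb_treespace[OF C xs(2)]] d[OF xs(2) q0] bhv_sym by metis
      then have "\<phi> (emb C q) + eucl_dist p (emb C x) (emb C q) < a" using q(2) by (simp add: field_simps)
      then show "x \<in> ?r" using x xs q(1) unfolding open_part_def by blast
    next
      fix x assume x: "x \<in> ?r"
      then obtain q where q: "q \<in> ?Q" "\<phi> (emb C q) + eucl_dist p (emb C x) (emb C q) < a" by blast
      have xs: "x \<in> space ?M" "\<forall>S\<in>C. 0 < x S" "emb C x \<in> treespace p" using x unfolding open_part_def by auto
      have q0: "\<forall>S\<in>C. 0 < q S" using q(1) by (auto simp: PiE_iff)
      have "\<phi> (emb C x) \<le> \<phi> (emb C q) + eucl_dist p (emb C x) (emb C q)"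
        using Lip[OF xs(3) emb_treespace[OF C q0]] d[OF xs(2) q0] by simp
      then show "x \<in> ?l" using q(2) xs unfolding open_part_def by auto
    qed
    also have "\<dots> \<in> sets ?M"
    proof (intro sets.Int open_part_treespace_measurable C sets.countable_UN'')
      show "countable ?Q"
        using topology_finite[OF C] countable_rat by (intro countable_PiE) (auto intro: countable_subset[of _ \<rat>])
      show "{x \<in> space ?M. \<phi> (emb C q) + eucl_dist p (emb C x) (emb C q) < a} \<in> sets ?M" if "q \<in> ?Q" for q
        using eucl_dist_emb_measurable by (intro borel_measurable_less borel_measurable_add) auto
    qed
    finally show ?thesis .
  qed
  then show "{x \<in> space (nu0 p). \<phi> x < a} \<in> sets (nu0 p)"
    unfolding sets_nu0 space_nu0 nu_sets_def by auto
qed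

lemma borel_measurable_nu: "g \<in> borel_measurable (nu0 p) \<Longrightarrow> g \<in> borel_measurable (nu p)"
  unfolding nu_def by (rule measurable_completion)

lemma dist_origin_measurable: "bhv_dist p (\<lambda>_. 0) \<in> borel_measurable (nu0 p)"
  using bhv_tri[OF zero_in_treespace] bhv_sym by (intro Lipschitz_measurable) metis

lemma ball_measure:
  fixes R :: real
  assumes R: "card (clades p) \<le> R"
  shows "\<exists>z>0. (\<integral>\<^sup>+x. ennreal (indicator {w. bhv_dist p (\<lambda>_. 0) w \<le> R} x) \<partial>nu p) = ennreal z"
proof -
  interpret product_sigma_finite "\<lambda>_::nat set. lborel :: real measure" by standard
  let ?B = "{w \<in> treespace p. bhv_dist p (\<lambda>_. 0) w \<le> R}"
  have R0: "0 \<le> R" using R by linarith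
  have B: "?B \<in> nu_sets p"
    using dist_origin_measurable[of p] borel_measurable_le[OF dist_origin_measurable[of p], of "\<lambda>_. R"]
    by (simp add: sets_nu0 space_nu0)
  have norm: "bhv_dist p (\<lambda>_. 0) w = eucl_dist p w (\<lambda>_. 0)" if "w \<in> treespace p" for w
    using bhv_eq_eucl[OF common_orthant_zero[OF that]] bhv_sym by metis
  have fin: "emeasure (PiM C (\<lambda>_. lborel)) (open_part C ?B) < \<infinity>" if C: "C \<in> topologies p" for C
  proof -
    have "open_part C ?B \<subseteq> (\<Pi>\<^sub>E S\<in>C. {0..R})"
    proof
      fix x assume "x \<in> open_part C ?B"
      then have x: "x \<in> space (PiM C (\<lambda>_. lborel :: real measure))" "\<forall>S\<in>C. 0 < x S" "emb C x \<in> ?B"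
        unfolding open_part_def by auto
      have "x S \<in> {0..R}" if S: "S \<in> C" for S
      proof -
        have "S \<in> clades p" using S C unfolding topologies_def by blast
        then have "\<bar>emb C x S\<bar> \<le> R"
          using coord_le_eucl_dist[of S p "emb C x" "\<lambda>_. 0"] x(3) norm[of "emb C x"] by auto
        then show ?thesis using S x(2) unfolding emb_def by auto
      qed
      then show "x \<in> (\<Pi>\<^sub>E S\<in>C. {0..R})" using x(1) by (auto simp: space_PiM PiE_iff)
    qed
    then have "emeasure (PiM C (\<lambda>_. lborel)) (open_part C ?B) \<le> emeasure (PiM C (\<lambda>_. lborel)) (\<Pi>\<^sub>E S\<in>C. {0..R})"
      using topology_finite[OF C] by (intro emeasure_mono sets_PiM_I_finite) auto
    also have "\<dots> = (\<Prod>S\<in>C. emeasure lborel {0..R})"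
      using topology_finite[OF C] by (intro emeasure_PiM) auto
    also have "\<dots> < \<infinity>" using R0 by (simp add: ennreal_power less_top)
    finally show ?thesis .
  qed
  obtain C where C: "C \<in> topologies p" using zero_in_treespace unfolding treespace_def by blast
  have pos: "0 < emeasure (PiM C (\<lambda>_. lborel)) (open_part C ?B)"
  proof -
    have "(\<Pi>\<^sub>E S\<in>C. {0<..1}) \<subseteq> open_part C ?B"
    proof
      fix x :: tree assume x: "x \<in> (\<Pi>\<^sub>E S\<in>C. {0<..1})"
      then have x0: "\<forall>S\<in>C. 0 < x S" and x1: "\<forall>S\<in>C. x S \<le> 1" by (auto simp: PiE_iff)
      have "eucl_dist p (emb C x) (\<lambda>_. 0) \<le> (\<Sum>S\<in>clades p. \<bar>emb C x S - 0\<bar>)"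
        unfolding eucl_dist_L2 by (rule L2_set_le_sum_abs)
      also have "\<dots> \<le> (\<Sum>S\<in>clades p. 1)"
        using x0 x1 by (intro sum_mono) (auto simp: emb_def)
      also have "\<dots> \<le> R" using R by simp
      finally show "x \<in> open_part C ?B"
        using x0 x emb_treespace[OF C x0] norm unfolding open_part_def by (auto simp: space_PiM PiE_iff)
    qed
    moreover have "emeasure (PiM C (\<lambda>_. lborel :: real measure)) (\<Pi>\<^sub>E S\<in>C. {0<..1}) = (\<Prod>S\<in>C. emeasure lborel {0<..1::real})"
      using topology_finite[OF C] by (intro emeasure_PiM) auto
    ultimately have "1 \<le> emeasure (PiM C (\<lambda>_. lborel)) (open_part C ?B)"
      using B C emeasure_mono[of "\<Pi>\<^sub>E S\<in>C. {0<..1}" "open_part C ?B" "PiM C (\<lambda>_. lborel)"]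
      unfolding nu_sets_def by simp
    then show ?thesis using less_le_trans zero_less_one by blast
  qed
  have "emeasure (nu0 p) ?B < \<infinity>" "0 < emeasure (nu0 p) ?B"
    unfolding emeasure_nu0[OF B] using fin pos C finite_topologies
    by (auto simp: sum_pos2[of _ C] intro: sum_pos2)
  moreover have "(\<integral>\<^sup>+x. ennreal (indicator {w. bhv_dist p (\<lambda>_. 0) w \<le> R} x) \<partial>nu p) = (\<integral>\<^sup>+x. indicator ?B x \<partial>nu0 p)"
    unfolding nu_def nn_integral_completion
    by (intro nn_integral_cong) (auto simp: space_nu0 indicator_def)
  moreover have "\<dots> = emeasure (nu0 p) ?B" using B by (simp add: sets_nu0)
  ultimately show ?thesis by (cases "emeasure (nu0 p) ?B") auto
qed

subsection \<open>Maximum likelihood estimators\<close>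

lemma normalized_F0:
  assumes meas: "g \<in> borel_measurable (nu p)" and nonneg: "\<forall>x\<in>treespace p. 0 \<le> g x"
    and usc: "usc_tree p g" and lc: "log_conc p g"
    and z: "0 < z" "(\<integral>\<^sup>+x. ennreal (g x) \<partial>nu p) = ennreal z"
  shows "(\<lambda>x. g x * (1 / z)) \<in> F0 p"
  unfolding F0_def
proof (intro CollectI conjI)
  have nn: "\<forall>x\<in>treespace p. 0 \<le> g x * (1 / z)" using nonneg z by simp
  have "(\<integral>\<^sup>+x. ennreal (g x * (1 / z)) \<partial>nu p) = (\<integral>\<^sup>+x. ennreal (g x) * ennreal (1 / z) \<partial>nu p)"
    using nonneg z by (intro nn_integral_cong ennreal_mult) (auto simp: space_nu)
  also have "\<dots> = (\<integral>\<^sup>+x. ennreal (g x) \<partial>nu p) * ennreal (1 / z)"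
    using meas by (intro nn_integral_multc) auto
  also have "\<dots> = 1" unfolding z(2) using z(1) by (simp flip: ennreal_mult')
  finally show "prob_density p (\<lambda>x. g x * (1 / z))" unfolding prob_density_def using nn meas by auto
  have c: "0 < 1 / z" using z by simp
  show "usc_tree p (\<lambda>x. g x * (1 / z))"
  proof (rule usc_tree_mult[OF usc _ nonneg])
    show "usc_tree p (\<lambda>x. 1 / z)" unfolding usc_tree_def using zero_less_one by blast
  qed (use c in auto)
  show "log_concave p (\<lambda>x. g x * (1 / z))"
    using log_conc_mult[OF lc log_conc_const[OF c] nonneg] c nn by (intro log_conc_imp_log_concave) auto
qed

lemma F0_D:
  assumes "f \<in> F0 p"
  shows "f \<in> borel_measurable (nu p)" "\<forall>x\<in>treespace p. 0 \<le> f x" "(\<integral>\<^sup>+x. ennreal (f x) \<partial>nu p) = 1"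
    "usc_tree p f" "log_conc p f"
  using assms log_concave_imp_log_conc unfolding F0_def prob_density_def by auto

lemma loglik_positive:
  "\<forall>i<n. 0 < g (X i) \<Longrightarrow> loglik n X g = ereal (\<Sum>i<n. ln (g (X i)))"
  unfolding loglik_def elog_def by (auto simp flip: sum_ereal intro!: sum.cong)

lemma loglik_finite_imp_nonzero:
  assumes "loglik n X f \<noteq> - \<infinity>" "i < n"
  shows "f (X i) \<noteq> 0"
proof
  assume 0: "f (X i) = 0"
  have "loglik n X f = elog (f (X i)) + (\<Sum>j\<in>{..<n} - {i}. elog (f (X j)))"
    unfolding loglik_def using assms(2) by (intro sum.remove) auto
  moreover have "(\<Sum>j\<in>{..<n} - {i}. elog (f (X j))) \<noteq> \<infinity>"
    by (simp add: sum_Pinfty elog_def)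
  ultimately have "loglik n X f = - \<infinity>" using 0 by (simp add: elog_def)
  then show False using assms(1) by simp
qed

lemma mle_positive:
  assumes X: "\<forall>i<n. X i \<in> treespace p" and f: "is_mle p n X f"
  shows "\<forall>i<n. 0 < f (X i)"
proof -
  define R where "R = card (clades p) + (\<Sum>i<n. bhv_dist p (\<lambda>_. 0) (X i))"
  let ?g = "\<lambda>x. indicator {w. bhv_dist p (\<lambda>_. 0) w \<le> R} x :: real"
  have d0: "0 \<le> bhv_dist p (\<lambda>_. 0) (X i)" if "i < n" for i
    using that X bhv_nonneg zero_in_treespace by blast
  have "card (clades p) \<le> R" unfolding R_def using d0 sum_nonneg[of "{..<n}" "\<lambda>i. bhv_dist p (\<lambda>_. 0) (X i)"] by simp
  then obtain z where z: "z > 0" "(\<integral>\<^sup>+x. ennreal (?g x) \<partial>nu p) = ennreal z" using ball_measure by blast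
  have "?g \<in> borel_measurable (nu0 p)"
  proof -
    have "{x \<in> space (nu0 p). bhv_dist p (\<lambda>_. 0) x \<le> R} \<in> sets (nu0 p)"
      by (intro borel_measurable_le dist_origin_measurable) auto
    moreover have "{w. bhv_dist p (\<lambda>_. 0) w \<le> R} \<inter> space (nu0 p) = {x \<in> space (nu0 p). bhv_dist p (\<lambda>_. 0) x \<le> R}"
      by blast
    ultimately show ?thesis by (simp add: borel_measurable_indicator_iff)
  qed
  then have F: "(\<lambda>x. ?g x * (1 / z)) \<in> F0 p"
    using z usc_ball log_conc_ball borel_measurable_nu by (intro normalized_F0) auto
  have "bhv_dist p (\<lambda>_. 0) (X i) \<le> R" if "i < n" for i
    unfolding R_def using that d0 member_le_sum[of i "{..<n}" "\<lambda>i. bhv_dist p (\<lambda>_. 0) (X i)"] by auto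
  then have "\<forall>i<n. 0 < ?g (X i) * (1 / z)" using z by simp
  then have "loglik n X (\<lambda>x. ?g x * (1 / z)) \<noteq> - \<infinity>" using loglik_positive by fastforce
  moreover have "loglik n X (\<lambda>x. ?g x * (1 / z)) \<le> loglik n X f" using F f unfolding is_mle_def by blast
  ultimately have "loglik n X f \<noteq> - \<infinity>" by auto
  then have "\<forall>i<n. f (X i) \<noteq> 0" using loglik_finite_imp_nonzero by blast
  moreover have "\<forall>i<n. 0 \<le> f (X i)" using F0_D(2) f X unfolding is_mle_def by blast
  ultimately show ?thesis by (simp add: less_le)
qed

lemma mle_unnormalized:
  assumes X: "\<forall>i<n. X i \<in> treespace p" and f: "is_mle p n X f"
    and g: "g \<in> borel_measurable (nu p)" "\<forall>x\<in>treespace p. 0 \<le> g x" "usc_tree p g" "log_conc p g"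
    and gX: "\<forall>i<n. 0 < g (X i)"
    and z: "0 < z" "(\<integral>\<^sup>+x. ennreal (g x) \<partial>nu p) = ennreal z"
  shows "(\<Sum>i<n. ln (g (X i))) \<le> n * ln z + (\<Sum>i<n. ln (f (X i)))"
proof -
  have "loglik n X (\<lambda>x. g x * (1 / z)) \<le> loglik n X f"
    using normalized_F0[OF g z] f unfolding is_mle_def by blast
  moreover have "\<forall>i<n. 0 < g (X i) * (1 / z)" using gX z by simp
  ultimately have "(\<Sum>i<n. ln (g (X i) * (1 / z))) \<le> (\<Sum>i<n. ln (f (X i)))"
    using loglik_positive[of n "\<lambda>x. g x * (1 / z)" X] loglik_positive[of n f X, OF mle_positive[OF X f]] by simp
  moreover have "(\<Sum>i<n. ln (g (X i) * (1 / z))) = (\<Sum>i<n. ln (g (X i)) - ln z)"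
    using gX z by (intro sum.cong) (auto simp: ln_div)
  ultimately show ?thesis by (simp add: sum_subtractf)
qed

lemma mle_overlap:
  assumes n: "1 \<le> n" and X: "\<forall>i<n. X i \<in> treespace p" and f1: "is_mle p n X f1" and f2: "is_mle p n X f2"
  shows "\<not> (AE x in nu p. f1 x * f2 x = 0)"
proof
  assume ae: "AE x in nu p. f1 x * f2 x = 0"
  have F1: "f1 \<in> F0 p" and F2: "f2 \<in> F0 p" using f1 f2 unfolding is_mle_def by auto
  note D1 = F0_D[OF F1] and D2 = F0_D[OF F2]
  note P1 = mle_positive[OF X f1] and P2 = mle_positive[OF X f2]
  define c where "c = Min ((\<lambda>i. min (f1 (X i)) (f2 (X i))) ` {..<n})"
  have ne: "{..<n} \<noteq> {}" using n lessThan_empty_iff[of n] by auto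
  have c: "0 < c" unfolding c_def using ne P1 P2 by (subst Min_gr_iff) auto
  have cX: "c \<le> f1 (X i)" "c \<le> f2 (X i)" if "i < n" for i
    using Min_le[of "(\<lambda>i. min (f1 (X i)) (f2 (X i))) ` {..<n}" "min (f1 (X i)) (f2 (X i))"] that
    unfolding c_def by auto
  define K where "K = {x \<in> treespace p. c \<le> f1 x} \<inter> {x \<in> treespace p. c \<le> f2 x}"
  have XK: "X i \<in> K" if "i < n" for i using cX that X unfolding K_def by auto
  have K: "K \<subseteq> treespace p" "K \<noteq> {}" using XK[of 0] n unfolding K_def by auto
  have Kc: "bhv.gconvex p K"
    using superlevel_gconvex[OF D1(5) c] superlevel_gconvex[OF D2(5) c]
    unfolding K_def bhv.gconvex_def by blast
  define h where "h x = exp (- set_dist p K x)" for x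
  have h_meas: "h \<in> borel_measurable (nu p)"
  proof -
    have "set_dist p K \<in> borel_measurable (nu0 p)"
      using set_dist_Lipschitz[OF K] by (intro Lipschitz_measurable)
    then show ?thesis unfolding h_def by (intro borel_measurable_nu) auto
  qed
  have h0: "0 < h x" for x unfolding h_def by simp
  have h1: "h x \<le> 1" if "x \<in> treespace p" for x
    using set_dist_nonneg[OF K that] unfolding h_def by simp
  have hK: "h x < 1" if "x \<in> treespace p" "x \<notin> K" for x
  proof -
    have "f1 x < c \<or> f2 x < c" using that unfolding K_def by auto
    then have "0 < set_dist p K x"
      using superlevel_closed[OF D1(4) that(1) _ _ K(2)] superlevel_closed[OF D2(4) that(1) _ _ K(2)]
      unfolding K_def by blast
    then show ?thesis unfolding h_def by simp
  qed
  have hX: "h (X i) = 1" if "i < n" for i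
    unfolding h_def using set_dist_zero[OF K XK[OF that]] by simp
  let ?g = "\<lambda>x. f1 x * h x"
  have g_meas: "?g \<in> borel_measurable (nu p)" using D1(1) h_meas by (intro borel_measurable_times)
  have gn: "\<forall>x\<in>treespace p. 0 \<le> ?g x" using D1(2) h0 by (simp add: less_imp_le)
  have notzero: "\<not> (AE x in nu p. f1 x \<le> 0)"
  proof
    assume "AE x in nu p. f1 x \<le> 0"
    then have "AE x in nu p. ennreal (f1 x) = 0" by eventually_elim (simp add: ennreal_neg)
    then have "(\<integral>\<^sup>+x. ennreal (f1 x) \<partial>nu p) = 0"
      using D1(1) by (subst nn_integral_0_iff_AE) auto
    then show False using D1(3) by simp
  qed
  have notin: "AE x in nu p. x \<in> treespace p \<and> x \<notin> K"
    using ae AE_space[of "nu p"] unfolding space_nu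
  proof eventually_elim
    fix x assume "f1 x * f2 x = 0" "x \<in> treespace p"
    then show "x \<in> treespace p \<and> x \<notin> K" using c unfolding K_def by auto
  qed
  have less: "(\<integral>\<^sup>+x. ennreal (?g x) \<partial>nu p) < (\<integral>\<^sup>+x. ennreal (f1 x) \<partial>nu p)"
  proof (rule nn_integral_less)
    have le: "ennreal (?g x) \<le> ennreal (f1 x)" if "x \<in> treespace p" for x
      using D1(2) h1[OF that] that by (intro ennreal_leI) (simp add: mult_left_le)
    then show "AE x in nu p. ennreal (?g x) \<le> ennreal (f1 x)"
      by (intro AE_I2) (simp add: space_nu)
    have "(\<integral>\<^sup>+x. ennreal (?g x) \<partial>nu p) \<le> (\<integral>\<^sup>+x. ennreal (f1 x) \<partial>nu p)"
      using le by (intro nn_integral_mono) (simp add: space_nu)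
    then show "(\<integral>\<^sup>+x. ennreal (?g x) \<partial>nu p) \<noteq> \<infinity>" unfolding D1(3) by (auto simp: top_unique)
    show "\<not> (AE x in nu p. ennreal (f1 x) \<le> ennreal (?g x))"
    proof
      assume "AE x in nu p. ennreal (f1 x) \<le> ennreal (?g x)"
      with notin have "AE x in nu p. f1 x \<le> 0"
      proof eventually_elim
        fix x assume x: "x \<in> treespace p \<and> x \<notin> K" and "ennreal (f1 x) \<le> ennreal (f1 x * h x)"
        then have "f1 x \<le> f1 x * h x" using gn by (simp add: ennreal_le_iff)
        then show "f1 x \<le> 0" using hK[of x] x by (smt (verit) mult_less_cancel_left2)
      qed
      then show False using notzero by blast
    qed
  qed (use D1(1) g_meas in auto)
  then obtain z where z: "0 \<le> z" "(\<integral>\<^sup>+x. ennreal (?g x) \<partial>nu p) = ennreal z" "z < 1"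
    unfolding D1(3) by (cases "\<integral>\<^sup>+x. ennreal (?g x) \<partial>nu p") (auto simp: ennreal_less_one_iff)
  have "z \<noteq> 0"
  proof
    assume "z = 0"
    then have "AE x in nu p. ennreal (?g x) = 0"
      using z(2) g_meas nn_integral_0_iff_AE[of "\<lambda>x. ennreal (?g x)" "nu p"] by simp
    then have "AE x in nu p. f1 x \<le> 0"
      by eventually_elim (use h0 in \<open>auto simp: ennreal_eq_0_iff mult_le_0_iff less_le_not_le\<close>)
    then show False using notzero by blast
  qed
  then have z0: "0 < z" using z by simp
  have "\<forall>i<n. 0 < ?g (X i)" using P1 h0 by simp
  then have "(\<Sum>i<n. ln (?g (X i))) \<le> n * ln z + (\<Sum>i<n. ln (f1 (X i)))"
    using mle_unnormalized[OF X f1 g_meas gn _ _ _ z0 z(2)] D1 h0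
      usc_tree_mult[OF D1(4) usc_exp_set_dist[OF K]] log_conc_mult[OF D1(5) log_conc_exp_set_dist[OF K Kc]]
    unfolding h_def by (simp add: less_imp_le)
  then have "0 \<le> n * ln z" using hX by simp
  then show False using n z0 z(3) ln_less_zero[of z] by (simp add: zero_le_mult_iff)
qed

theorem theorem4:
  fixes p n :: nat and X :: "nat \<Rightarrow> tree" and f1 f2 :: "tree \<Rightarrow> real"
  assumes "1 \<le> p" and "1 \<le> n"
    and "\<forall>i<n. X i \<in> treespace p"
    and "is_mle p n X f1" and "is_mle p n X f2"
  shows "AE x in nu p. f1 x = f2 x"
proof -
  note n = assms(2) and X = assms(3) and f1 = assms(4) and f2 = assms(5)
  have F1: "f1 \<in> F0 p" and F2: "f2 \<in> F0 p" using f1 f2 unfolding is_mle_def by auto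
  note D1 = F0_D[OF F1] and D2 = F0_D[OF F2]
  note P1 = mle_positive[OF X f1] and P2 = mle_positive[OF X f2]
  let ?g = "\<lambda>x. sqrt (f1 x * f2 x)" and ?a = "\<lambda>x. (f1 x + f2 x) / 2"
  have g_meas: "?g \<in> borel_measurable (nu p)" using D1(1) D2(1) by auto
  have prod: "\<forall>x\<in>treespace p. 0 \<le> f1 x * f2 x" using D1(2) D2(2) by simp
  have amgm: "?g x \<le> ?a x" if "x \<in> treespace p" for x
    using arith_geo_mean_sqrt D1(2) D2(2) that by blast
  have mean: "(\<integral>\<^sup>+x. ennreal (?a x) \<partial>nu p) = 1"
  proof -
    have "(\<integral>\<^sup>+x. ennreal (?a x) \<partial>nu p) = (\<integral>\<^sup>+x. ennreal (1 / 2) * (ennreal (f1 x) + ennreal (f2 x)) \<partial>nu p)"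
    proof (rule nn_integral_cong)
      fix x assume "x \<in> space (nu p)"
      then have nn: "0 \<le> f1 x" "0 \<le> f2 x" using D1(2) D2(2) by (auto simp: space_nu)
      have "ennreal (?a x) = ennreal (1 / 2 * (f1 x + f2 x))" by simp
      also have "\<dots> = ennreal (1 / 2) * ennreal (f1 x + f2 x)" using nn by (intro ennreal_mult) auto
      finally show "ennreal (?a x) = ennreal (1 / 2) * (ennreal (f1 x) + ennreal (f2 x))" using nn by simp
    qed
    also have "\<dots> = ennreal (1 / 2) * (1 + 1)"
      using D1 D2 by (simp add: nn_integral_cmult nn_integral_add)
    also have "\<dots> = ennreal (1 / 2) * ennreal 2" by simp
    also have "\<dots> = ennreal (1 / 2 * 2)" by (rule ennreal_mult[symmetric]) auto
    also have "\<dots> = 1" by simp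
    finally show ?thesis .
  qed
  have "(\<integral>\<^sup>+x. ennreal (?g x) \<partial>nu p) \<le> (\<integral>\<^sup>+x. ennreal (?a x) \<partial>nu p)"
    using amgm by (intro nn_integral_mono ennreal_leI) (simp add: space_nu)
  then have le1: "(\<integral>\<^sup>+x. ennreal (?g x) \<partial>nu p) \<le> 1" unfolding mean .
  then obtain z where z: "0 \<le> z" "(\<integral>\<^sup>+x. ennreal (?g x) \<partial>nu p) = ennreal z"
    by (cases "\<integral>\<^sup>+x. ennreal (?g x) \<partial>nu p") (auto simp: top_unique)
  have "z \<noteq> 0"
  proof
    assume "z = 0"
    then have "AE x in nu p. ennreal (?g x) = 0"
      using z(2) g_meas nn_integral_0_iff_AE[of "\<lambda>x. ennreal (?g x)" "nu p"] by simp
    then have "AE x in nu p. f1 x * f2 x = 0"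
      using AE_space[of "nu p"] unfolding space_nu
    proof eventually_elim
      fix x assume "ennreal (?g x) = 0" "x \<in> treespace p"
      then have "f1 x * f2 x \<le> 0" by (simp add: ennreal_eq_0_iff)
      then show "f1 x * f2 x = 0" using prod \<open>x \<in> treespace p\<close> by (intro order_antisym) auto
    qed
    then show False using mle_overlap[OF n X f1 f2] by blast
  qed
  then have z0: "0 < z" using z by simp
  have "(\<Sum>i<n. ln (?g (X i))) \<le> n * ln z + (\<Sum>i<n. ln (f1 (X i)))"
    using P1 P2 prod
    by (intro mle_unnormalized[OF X f1 g_meas _ _ _ _ z0 z(2)] usc_tree_sqrt log_conc_sqrt
        usc_tree_mult log_conc_mult D1 D2) auto
  moreover have "(\<Sum>i<n. ln (?g (X i))) = (\<Sum>i<n. ln (f1 (X i)) / 2 + ln (f2 (X i)) / 2)"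
  proof (rule sum.cong[OF refl])
    fix i assume "i \<in> {..<n}"
    then have "0 < f1 (X i)" "0 < f2 (X i)" using P1 P2 by auto
    then show "ln (?g (X i)) = ln (f1 (X i)) / 2 + ln (f2 (X i)) / 2"
      by (simp add: real_sqrt_mult ln_mult_pos ln_sqrt)
  qed
  moreover have "(\<Sum>i<n. ln (f1 (X i))) = (\<Sum>i<n. ln (f2 (X i)))"
  proof -
    have "loglik n X f1 = loglik n X f2"
      using f1 f2 F1 F2 unfolding is_mle_def by (intro order_antisym) auto
    then show ?thesis 
      unfolding loglik_positive[of n f1 X, OF P1] loglik_positive[of n f2 X, OF P2] by simp
  qed
  ultimately have "0 \<le> n * ln z" by (simp add: sum.distrib flip: sum_divide_distrib)
  then have "1 \<le> z" using n z0 by (simp add: zero_le_mult_iff)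
  then have "\<not> (\<integral>\<^sup>+x. ennreal (?g x) \<partial>nu p) < (\<integral>\<^sup>+x. ennreal (?a x) \<partial>nu p)"
    unfolding mean z(2) by (simp add: not_less)
  moreover have "(\<integral>\<^sup>+x. ennreal (?g x) \<partial>nu p) \<noteq> \<infinity>" using z by simp
  moreover have "AE x in nu p. ennreal (?g x) \<le> ennreal (?a x)"
    using amgm by (intro AE_I2 ennreal_leI) (simp add: space_nu)
  moreover have "(\<lambda>x. ennreal (?g x)) \<in> borel_measurable (nu p)" "(\<lambda>x. ennreal (?a x)) \<in> borel_measurable (nu p)"
    using D1(1) D2(1) by auto
  ultimately have "AE x in nu p. ennreal (?a x) \<le> ennreal (?g x)"
    using nn_integral_less[of "\<lambda>x. ennreal (?g x)" "nu p" "\<lambda>x. ennreal (?a x)"] by blast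
  then show ?thesis
    using AE_space[of "nu p"] unfolding space_nu
  proof eventually_elim
    fix x assume le: "ennreal (?a x) \<le> ennreal (?g x)" and x: "x \<in> treespace p"
    have nn: "0 \<le> f1 x" "0 \<le> f2 x" using D1(2) D2(2) x by auto
    then have "?a x \<le> ?g x" using le by (simp add: ennreal_le_iff)
    then have "(?a x)\<^sup>2 \<le> f1 x * f2 x" using nn by (metis add_nonneg_nonneg divide_nonneg_pos mult_nonneg_nonneg power_mono real_sqrt_pow2 zero_less_numeral)
    then have "(f1 x - f2 x)\<^sup>2 \<le> 0" by (simp add: power2_eq_square field_simps)
    then show "f1 x = f2 x" by simp
  qed
qed

end
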